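(* Let $\mathscr T=(V,E)$ be a rootless directed tree and let $\mathscr T_\infty$ be the extended directed tree associated with $\mathscr T$, with vertex set $V_\infty=V\sqcup\{\infty\}$. For $b\in V_\infty$, $u\in V\setminus\{b\}$ and a weight system $\lambda_u=\{\lambda_{uv}\}_{v\in V_\infty}$ of complex numbers, let $D_{\lambda_u}$ be the diagonal operator on $\mathscr T$ and let $W^{(b)}_{\lambda_u}$ be the weighted join operator on $\mathscr T$. Then: (i) Assume that $b\in V$. Consider the subspace $$\mathscr H^{(b)}_u=\begin{cases}\ell^2(\mathsf{Asc}(u)\cup\mathsf{Des}_b(u))&\text{if } b\in\mathsf{Des}(u),\\ \ell^2(\mathsf{Des}_u(u))&\text{otherwise}\end{cases}$$ of $\ell^2(V)$. Then $W^{(b)}_{\lambda_u}$ admits the decomposition $W^{(b)}_{\lambda_u}=D^{(b)}_{\lambda_u}\oplus N^{(b)}_{\lambda_u}$ on $\ell^2(V)=\mathscr H^{(b)}_u\oplus(\ell^2(V)\ominus\mathscr H^{(b)}_u)$, where $D^{(b)}_{\lambda_u}$ is a densely defined diagonal operator in $\mathscr H^{(b)}_u$ and $N^{(b)}_{\lambda_u}$ is a densely defined linear operator of rank at most one in $\ell^2(V)\ominus\mathscr H^{(b)}_u$ with invariant domain. Further, $$D^{(b)}_{\lambda_u}=D_{\lambda_u}|_{\mathscr H^{(b)}_u},\quad \mathscr D(D^{(b)}_{\lambda_u})=\{f\in\mathscr H^{(b)}_u:D_{\lambda_u}f\in\mathscr H^{(b)}_u\},\qquad N^{(b)}_{\lambda_u}=e_u\oslash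 e_{\lambda_u,A_u},$$ where $A_u=[u,b]$ if $b\in\mathsf{Des}(u)$ and $A_u=\mathsf{Asc}(u)\cup\{b,u\}$ otherwise. (ii) Assume that $b=\infty$. Put $u_j:=\mathsf{par}^{\langle j\rangle}(u)$ for $j\in\mathbb N=\{0,1,2,\dots\}$ and $\mathsf{Des}(u_{-1})=\emptyset$, and consider the orthogonal decomposition $\ell^2(V)=\bigoplus_{j=0}^\infty\ell^2(\mathsf{Des}(u_j)\setminus\mathsf{Des}(u_{j-1}))$. With respect to this decomposition, $W^{(\infty)}_{\lambda_u}$ decomposes as $$\mathscr D(W^{(\infty)}_{\lambda_u})=\bigoplus_{j=0}^\infty\mathscr D\big(e_{u_j}\oslash e_{\lambda_u,\mathsf{Des}(u_j)\setminus\mathsf{Des}(u_{j-1})}\big),\qquad W^{(\infty)}_{\lambda_u}=\bigoplus_{j=0}^\infty e_{u_j}\oslash e_{\lambda_u,\mathsf{Des}(u_j)\setminus\mathsf{Des}(u_{j-1})}.$$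
   Context: Trees. A directed tree $\mathscr T=(V,E)$ is a directed graph (no loops, $V$ and $E$ nonempty) which has no circuits, is connected (ignoring orientation), and in which every vertex with an incoming edge has exactly one parent $\mathsf{par}(v)$; it is rootless if every vertex has a parent. Throughout $\mathrm{card}(V)=\aleph_0$. $\mathsf{Des}(u)\subseteq V$ is the set of descendants of $u$, including $u$; $\mathsf{Asc}(u)=\{\mathsf{par}^{\langle n\rangle}(u):n\ge1\}$ (infinite here). For $v\in\mathsf{Des}(u)$, $[u,v]$ is the set of vertices of the directed path from $u$ to $v$ and $\mathsf{Des}_v(u)=\mathsf{Des}(u)\setminus[u,v]$; so $\mathsf{Des}_u(u)=\mathsf{Des}(u)\setminus\{u\}$. Join operations. The extended tree has vertex set $V_\infty=V\sqcup\{\infty\}$ with $\infty$ declared a child (hence a descendant) of every $v\in V$, and $\mathsf{Asc}(\infty)=V$. Write $u\le v$ if there is a directed path from $u$ to $v$ in $\mathscr T_\infty$ (including $u=v$). $u\sqcup v=u$ if $v\le u$; $=v$ if $u\le v$; $=\infty$ otherwise. For $u,v\in V$, the set of $w\in V$ with $\mathsf{par}^{\langle n\rangle}(u)=w=\mathsf{par}^{\langle m\rangle}(v)$ for some $m,n\ge0$ is nonempty and totally ordered by $\le$, and $u\sqcap v$ is its $\le$-maximum (equivalently $\max([w_0,u]\cap[w_0,v])$ for any $w_0$ in it); $u\sqcap\infty=u=\infty\sqcap u$. For $b\in V_\infty$: $u\sqcup_bv=u\sqcap v$ if $u,v\in\mathsf{Asc}(b)$; $=u$ if $v=b$; $=v$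 if $u=b$; $=u\sqcup v$ otherwise. Operators. A weight system is a family $\{\lambda_{uv}\}_{v\in V_\infty}\subseteq\mathbb C$ with $\lambda_{u\infty}=0$. $W^{(b)}_{\lambda_u}$ is the operator in $\ell^2(V)$ with domain $\{f\in\ell^2(V):\Lambda^{(b)}_uf\in\ell^2(V)\}$ and $W^{(b)}_{\lambda_u}f=\Lambda^{(b)}_uf$, where $(\Lambda^{(b)}_uf)(w)=\sum_{v\in V:\,u\sqcup_bv=w}\lambda_{uv}f(v)$, $w\in V$ (these series are required to converge). $D_{\lambda_u}f=\sum_v\lambda_{uv}f(v)e_v$ on $\{f\in\ell^2(V):\sum_v|\lambda_{uv}|^2|f(v)|^2<\infty\}$. For $A\subseteq V$, $e_{\lambda_u,A}:V\to\mathbb C$ is the function $\sum_{v\in A}\overline{\lambda_{uv}}e_v$ (not necessarily square summable). For a function $g$ on an index set $J$ and a vector $x$, $x\oslash g$ is the operator $h\mapsto\big(\sum_{j\in J}h(j)\overline{g(j)}\big)x$ with domain consisting of those $h$ in the relevant space for which the series converges; in (i) the space is $\ell^2(V)\ominus\mathscr H^{(b)}_u$, and in (ii) the $j$-th operator acts in $\ell^2(\mathsf{Des}(u_j)\setminus\mathsf{Des}(u_{j-1}))$. An operator $T$ has invariant domain if $T\mathscr D(T)\subseteq\mathscr D(T)$. The infinite direct sum of operators is the usual Hilbert space direct sum.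
   Formalization: In (ii), the direct sum of the domains is read as the domain of the direct sum of the operators, i.e. with the added condition that the squared norms of the images of the components are summable; without it the domain formula fails, e.g. for unbounded weights at the ancestors of u. *)

theory Defs
  imports
    "HOL-Analysis.Analysis"
    "HOL-Library.Function_Algebras"
    "Graph_Theory.Graph_Theory"
begin

section \<open>Directed trees\<close>

text \<open>Since there are no loops, the cycles of the graph library have length at least two and
  distinct vertices, i.e. they are circuits; \<^const>\<open>connected\<close> ignores orientation.\<close>

locale directed_tree = pair_loopfree_digraph +
  assumes verts_nonempty: "pverts G \<noteq> {}"
    and arcs_nonempty: "parcs G \<noteq> {}"
    and no_circuits: "\<not> (\<exists>p. cycle p)"
    and weakly_connected: "connected (with_proj G)"
    and unique_parent: "\<And>v. \<exists>w. (w, v) \<in> parcs G \<Longrightarrow> \<exists>!w. (w, v) \<in> parcs G"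

locale rootless_directed_tree = directed_tree +
  assumes rootless: "\<And>v. v \<in> pverts G \<Longrightarrow> \<exists>w. (w, v) \<in> parcs G"

text \<open>\<open>par\<close> is meaningful at vertices that have a parent, so in a rootless tree at all vertices.\<close>

definition par :: "'a pair_pre_digraph \<Rightarrow> 'a \<Rightarrow> 'a" where
  "par G v = (THE w. (w, v) \<in> parcs G)"

definition Des :: "'a pair_pre_digraph \<Rightarrow> 'a \<Rightarrow> 'a set" where
  "Des G u = {v \<in> pverts G. u \<rightarrow>\<^sup>*\<^bsub>with_proj G\<^esub> v}"

definition Asc :: "'a pair_pre_digraph \<Rightarrow> 'a \<Rightarrow> 'a set" where
  "Asc G u = {(par G ^^ n) u | n. n \<ge> 1}"

text \<open>The vertices of the directed path from \<open>u\<close> to \<open>v\<close>.\<close>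

definition path_verts :: "'a pair_pre_digraph \<Rightarrow> 'a \<Rightarrow> 'a \<Rightarrow> 'a set" where
  "path_verts G u v =
    {w. \<exists>p. pre_digraph.apath (with_proj G) u p v \<and> w \<in> set (pre_digraph.awalk_verts (with_proj G) u p)}"

text \<open>\<open>Des_off G v u\<close> is $\mathsf{Des}_v(u)$.\<close>

definition Des_off :: "'a pair_pre_digraph \<Rightarrow> 'a \<Rightarrow> 'a \<Rightarrow> 'a set" where
  "Des_off G v u = Des G u - path_verts G u v"


section \<open>The extended tree and the join operations\<close>

text \<open>In the extended tree, \<^const>\<open>None\<close> is the vertex at infinity.\<close>

definition ext_tree :: "'a pair_pre_digraph \<Rightarrow> 'a option pair_pre_digraph" where
  "ext_tree G = \<lparr> pverts = insert None (Some ` pverts G),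
     parcs = {(Some u, Some v) | u v. (u, v) \<in> parcs G} \<union> {(Some v, None) | v. v \<in> pverts G} \<rparr>"

definition tree_le :: "'a pair_pre_digraph \<Rightarrow> 'a option \<Rightarrow> 'a option \<Rightarrow> bool" where
  "tree_le G u v \<longleftrightarrow> u \<rightarrow>\<^sup>*\<^bsub>with_proj (ext_tree G)\<^esub> v"

definition Asc_ext :: "'a pair_pre_digraph \<Rightarrow> 'a option \<Rightarrow> 'a option set" where
  "Asc_ext G u = (case u of None \<Rightarrow> Some ` pverts G | Some v \<Rightarrow> Some ` Asc G v)"

definition tree_join :: "'a pair_pre_digraph \<Rightarrow> 'a option \<Rightarrow> 'a option \<Rightarrow> 'a option" where
  "tree_join G u v = (if tree_le G v u then u else if tree_le G u v then v else None)"

definition common_anc :: "'a pair_pre_digraph \<Rightarrow> 'a \<Rightarrow> 'a \<Rightarrow> 'a set" where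
  "common_anc G u v = {w \<in> pverts G. \<exists>m n. (par G ^^ n) u = w \<and> w = (par G ^^ m) v}"

definition tree_meet :: "'a pair_pre_digraph \<Rightarrow> 'a option \<Rightarrow> 'a option \<Rightarrow> 'a option" where
  "tree_meet G u v = (case u of None \<Rightarrow> v | Some x \<Rightarrow> (case v of None \<Rightarrow> u | Some y \<Rightarrow>
     Some (THE w. w \<in> common_anc G x y \<and> (\<forall>w' \<in> common_anc G x y. tree_le G (Some w') (Some w)))))"

definition join_at :: "'a pair_pre_digraph \<Rightarrow> 'a option \<Rightarrow> 'a option \<Rightarrow> 'a option \<Rightarrow> 'a option" where
  "join_at G b u v =
    (if u \<in> Asc_ext G b \<and> v \<in> Asc_ext G b then tree_meet G u v
     else if v = b then u
     else if u = b then v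
     else tree_join G u v)"


section \<open>Square summable functions\<close>

text \<open>For a set \<open>A\<close>, the space $\ell^2(A)$ consists of functions on the whole type that vanish
  outside \<open>A\<close>. So for \<open>A \<subseteq> V\<close> the space $\ell^2(A)$ is literally a subspace of $\ell^2(V)$, and
  norm and inner product need not mention the index set.\<close>

definition l2 :: "'a set \<Rightarrow> ('a \<Rightarrow> complex) set" where
  "l2 A = {f. (\<forall>v. v \<notin> A \<longrightarrow> f v = 0) \<and> (\<lambda>v. (cmod (f v))\<^sup>2) summable_on UNIV}"

definition l2_inner :: "('a \<Rightarrow> complex) \<Rightarrow> ('a \<Rightarrow> complex) \<Rightarrow> complex" where
  "l2_inner f g = (\<Sum>\<^sub>\<infinity>v. f v * cnj (g v))"

definition l2_norm :: "('a \<Rightarrow> complex) \<Rightarrow> real" where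
  "l2_norm f = sqrt (\<Sum>\<^sub>\<infinity>v. (cmod (f v))\<^sup>2)"

definition cscale :: "complex \<Rightarrow> ('a \<Rightarrow> complex) \<Rightarrow> ('a \<Rightarrow> complex)" where
  "cscale c f = (\<lambda>v. c * f v)"

global_interpretation cfun: vector_space "cscale :: complex \<Rightarrow> ('a \<Rightarrow> complex) \<Rightarrow> ('a \<Rightarrow> complex)"
  by unfold_locales (auto simp: cscale_def fun_eq_iff algebra_simps)

definition orth_compl :: "('a \<Rightarrow> complex) set \<Rightarrow> ('a \<Rightarrow> complex) set \<Rightarrow> ('a \<Rightarrow> complex) set" where
  "orth_compl K H = {f \<in> K. \<forall>h \<in> H. l2_inner f h = 0}"

definition l2_has_sum :: "('i \<Rightarrow> ('a \<Rightarrow> complex)) \<Rightarrow> 'i set \<Rightarrow> ('a \<Rightarrow> complex) \<Rightarrow> bool" where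
  "l2_has_sum F J f \<longleftrightarrow>
    f \<in> l2 UNIV \<and> ((\<lambda>S. l2_norm (f - (\<Sum>j\<in>S. F j))) \<longlongrightarrow> 0) (finite_subsets_at_top J)"

definition orthogonal_decomposition ::
    "('a \<Rightarrow> complex) set \<Rightarrow> 'i set \<Rightarrow> ('i \<Rightarrow> ('a \<Rightarrow> complex) set) \<Rightarrow> bool" where
  "orthogonal_decomposition K J M \<longleftrightarrow>
    (\<forall>j\<in>J. cfun.subspace (M j) \<and> M j \<subseteq> K) \<and>
    (\<forall>i\<in>J. \<forall>j\<in>J. i \<noteq> j \<longrightarrow> (\<forall>f \<in> M i. \<forall>g \<in> M j. l2_inner f g = 0)) \<and>
    K = {f. \<exists>F. (\<forall>j\<in>J. F j \<in> M j) \<and> l2_has_sum F J f}"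


section \<open>Unbounded operators\<close>

text \<open>An operator is a partial function \<open>T\<close> with domain \<open>dom T\<close> and range \<open>ran T\<close>; equality of
  operators includes equality of the domains.\<close>

type_synonym 'a l2_op = "('a \<Rightarrow> complex) \<rightharpoonup> ('a \<Rightarrow> complex)"

definition linear_operator_in :: "('a \<Rightarrow> complex) set \<Rightarrow> 'a l2_op \<Rightarrow> bool" where
  "linear_operator_in H T \<longleftrightarrow>
    cfun.subspace (dom T) \<and> dom T \<subseteq> H \<and> ran T \<subseteq> H \<and>
    (\<forall>f \<in> dom T. \<forall>g \<in> dom T. the (T (f + g)) = the (T f) + the (T g)) \<and>
    (\<forall>c. \<forall>f \<in> dom T. the (T (cscale c f)) = cscale c (the (T f)))"

definition densely_defined_in :: "('a \<Rightarrow> complex) set \<Rightarrow> 'a l2_op \<Rightarrow> bool" where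
  "densely_defined_in H T \<longleftrightarrow>
    dom T \<subseteq> H \<and> (\<forall>f \<in> H. \<forall>\<epsilon>>0. \<exists>g \<in> dom T. l2_norm (f - g) < \<epsilon>)"

text \<open>For a linear operator: the dimension of the range is finite and at most \<open>n\<close>.
  (\<open>cfun.dim\<close> would be \<open>0\<close> for an infinite-dimensional range.)\<close>

definition rank_at_most :: "nat \<Rightarrow> 'a l2_op \<Rightarrow> bool" where
  "rank_at_most n T \<longleftrightarrow>
    (\<exists>B. finite B \<and> card B \<le> n \<and> cfun.independent B \<and> cfun.span B = ran T)"

definition invariant_domain :: "'a l2_op \<Rightarrow> bool" where
  "invariant_domain T \<longleftrightarrow> ran T \<subseteq> dom T"

definition diag_op :: "'a set \<Rightarrow> ('a \<Rightarrow> complex) \<Rightarrow> 'a l2_op" where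
  "diag_op A \<mu> f =
    (if f \<in> l2 A \<and> (\<lambda>v. (cmod (\<mu> v))\<^sup>2 * (cmod (f v))\<^sup>2) summable_on A
     then Some (\<lambda>v. \<mu> v * f v) else None)"

definition diagonal_operator_in :: "'a set \<Rightarrow> 'a l2_op \<Rightarrow> bool" where
  "diagonal_operator_in A T \<longleftrightarrow> (\<exists>\<mu>. T = diag_op A \<mu>)"

text \<open>The operator $x \oslash g$ in the space \<open>H\<close>, for \<open>g\<close> defined on \<open>J\<close>.\<close>

definition oslash ::
    "('a \<Rightarrow> complex) set \<Rightarrow> 'a set \<Rightarrow> ('a \<Rightarrow> complex) \<Rightarrow> ('a \<Rightarrow> complex) \<Rightarrow> 'a l2_op" where
  "oslash H J x g h =
    (if h \<in> H \<and> (\<lambda>j. h j * cnj (g j)) summable_on J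
     then Some (cscale (\<Sum>\<^sub>\<infinity>j\<in>J. h j * cnj (g j)) x) else None)"

text \<open>The Hilbert space direct sum of operators \<open>T j\<close> acting in pairwise orthogonal subspaces.
  The element $(F_j)_j$ of the direct sum of the subspaces is identified with the norm limit
  $f = \sum_j F_j$; by orthogonality the latter exists iff $\sum_j \|F_j\|^2 < \infty$, and it
  determines the $F_j$.\<close>

definition direct_sum_dom :: "'i set \<Rightarrow> ('i \<Rightarrow> 'a l2_op) \<Rightarrow> ('a \<Rightarrow> complex) set" where
  "direct_sum_dom J T =
    {f. \<exists>F. (\<forall>j\<in>J. F j \<in> dom (T j)) \<and> l2_has_sum F J f \<and>
            (\<lambda>j. (l2_norm (the (T j (F j))))\<^sup>2) summable_on J}"

definition direct_sum :: "'i set \<Rightarrow> ('i \<Rightarrow> 'a l2_op) \<Rightarrow> 'a l2_op" where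
  "direct_sum J T f =
    (if f \<in> direct_sum_dom J T
     then Some (THE g. \<exists>F. (\<forall>j\<in>J. F j \<in> dom (T j)) \<and> l2_has_sum F J f \<and>
                            l2_has_sum (\<lambda>j. the (T j (F j))) J g)
     else None)"

text \<open>Sums of two subspaces or operators are sums over the index type \<^typ>\<open>bool\<close>.\<close>

abbreviation orthogonal_decomposition2 ::
    "('a \<Rightarrow> complex) set \<Rightarrow> ('a \<Rightarrow> complex) set \<Rightarrow> ('a \<Rightarrow> complex) set \<Rightarrow> bool" where
  "orthogonal_decomposition2 K H1 H2 \<equiv> orthogonal_decomposition K UNIV (case_bool H1 H2)"

abbreviation direct_sum2 :: "'a l2_op \<Rightarrow> 'a l2_op \<Rightarrow> 'a l2_op" where
  "direct_sum2 S T \<equiv> direct_sum UNIV (case_bool S T)"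


section \<open>Weighted join operators\<close>

text \<open>Throughout, \<open>lam\<close> is the weight system of a fixed vertex \<open>u\<close>, indexed by the vertices of the
  extended tree.\<close>

definition join_preimage ::
    "'a pair_pre_digraph \<Rightarrow> 'a option \<Rightarrow> 'a \<Rightarrow> 'a \<Rightarrow> 'a set" where
  "join_preimage G b u w = {v \<in> pverts G. join_at G b (Some u) (Some v) = Some w}"

definition join_map ::
    "'a pair_pre_digraph \<Rightarrow> 'a option \<Rightarrow> 'a \<Rightarrow> ('a option \<Rightarrow> complex) \<Rightarrow> ('a \<Rightarrow> complex) \<Rightarrow> ('a \<Rightarrow> complex)" where
  "join_map G b u lam f =
    (\<lambda>w. if w \<in> pverts G then \<Sum>\<^sub>\<infinity>v\<in>join_preimage G b u w. lam (Some v) * f v else 0)"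

definition weighted_join ::
    "'a pair_pre_digraph \<Rightarrow> 'a option \<Rightarrow> 'a \<Rightarrow> ('a option \<Rightarrow> complex) \<Rightarrow> 'a l2_op" where
  "weighted_join G b u lam f =
    (if f \<in> l2 (pverts G) \<and>
        (\<forall>w \<in> pverts G. (\<lambda>v. lam (Some v) * f v) summable_on join_preimage G b u w) \<and>
        join_map G b u lam f \<in> l2 (pverts G)
     then Some (join_map G b u lam f) else None)"

definition weight_diag :: "'a pair_pre_digraph \<Rightarrow> ('a option \<Rightarrow> complex) \<Rightarrow> 'a l2_op" where
  "weight_diag G lam = diag_op (pverts G) (\<lambda>v. lam (Some v))"

definition weight_vec :: "('a option \<Rightarrow> complex) \<Rightarrow> 'a set \<Rightarrow> ('a \<Rightarrow> complex)" where
  "weight_vec lam A = (\<lambda>v. if v \<in> A then cnj (lam (Some v)) else 0)"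

text \<open>The index sets of $\mathscr H^{(b)}_u$ and of the vector $e_{\lambda_u, A_u}$, for \<open>b \<in> V\<close>.\<close>

definition diag_verts :: "'a pair_pre_digraph \<Rightarrow> 'a \<Rightarrow> 'a \<Rightarrow> 'a set" where
  "diag_verts G b u = (if b \<in> Des G u then Asc G u \<union> Des_off G b u else Des_off G u u)"

definition rank_one_verts :: "'a pair_pre_digraph \<Rightarrow> 'a \<Rightarrow> 'a \<Rightarrow> 'a set" where
  "rank_one_verts G b u = (if b \<in> Des G u then path_verts G u b else Asc G u \<union> {b, u})"

text \<open>\<open>layer G u j\<close> is $\mathsf{Des}(u_j) \setminus \mathsf{Des}(u_{j-1})$ with $u_j$ the
  \<open>j\<close>-fold parent of \<open>u\<close>.\<close>

definition layer :: "'a pair_pre_digraph \<Rightarrow> 'a \<Rightarrow> nat \<Rightarrow> 'a set" where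
  "layer G u j =
    Des G ((par G ^^ j) u) - (if j = 0 then {} else Des G ((par G ^^ (j - 1)) u))"

end

theory Submission
  imports Defs
begin

text \<open>
  Fix \<open>u\<close> and let \<open>v\<close> vary. The operator is determined by the map that sends \<open>v\<close> to the join of \<open>u\<close> and
  \<open>v\<close>: its value at \<open>w\<close> is the weighted sum of \<open>f\<close> over the fibre of that map above \<open>w\<close>. The theorem
  holds because this map sends each block of a suitable partition of the vertices into the same
  block or to infinity, and is very simple on each block.

  At a finite base point \<open>b\<close> (\<open>join_at_vertex\<close>) the map is the identity on the set of diagonal
  vertices, sends a second set, disjoint from the first and containing \<open>u\<close>, to \<open>u\<close>, and sends all
  other vertices to infinity. The first set gives a diagonal operator. On its complement the image
  is the multiple of the unit vector at \<open>u\<close> by one weighted sum, which is an operator of rank at most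
  one (\<open>weighted_join_vertex\<close>). At the base point infinity (\<open>join_at_infinity\<close>) the map sends the
  \<open>j\<close>-th layer to the \<open>j\<close>-fold parent of \<open>u\<close>, which lies in that layer, and by connectedness the layers
  exhaust the tree; so there is one rank-one operator for each layer (\<open>weighted_join_infinity\<close>).

  Two ingredients make this precise. On the side of the tree, being a descendant is a partial order
  in which the ancestors of a vertex form a chain and any two vertices have a common ancestor; the
  join tables follow from this. On the side of operators, a norm convergent sum of functions with
  disjoint supports is the same as a square summable function together with its restrictions
  (\<open>l2_has_sum_disjoint\<close>), and square summability of the image is the same as square summability of
  the norms of its blocks (\<open>l2_iff_blocks\<close>). Hence the weighted join is the direct sum of its
  restrictions to the blocks, with the same domain (\<open>direct_sum_by_blocks\<close>). The same lemma serves
  for two blocks and for infinitely many.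

  Density of the domains and invariance of the domain of the rank-one part come from finitely
  supported functions, on which all series are finite sums.
\<close>


section \<open>The descendant order of a rootless directed tree\<close>

lemma funpow_diff: "m \<le> n \<Longrightarrow> (f ^^ (n - m)) ((f ^^ m) x) = (f ^^ n) x"
  by (metis comp_apply funpow_add le_add_diff_inverse2)

context rootless_directed_tree
begin

lemma arc_iff_par: "(w, v) \<in> parcs G \<longleftrightarrow> v \<in> pverts G \<and> w = par G v"
proof -
  have "(w, v) \<in> parcs G \<longleftrightarrow> w = par G v" if "v \<in> pverts G"
  proof -
    have ex1: "\<exists>!w. (w, v) \<in> parcs G" using unique_parent rootless that by simp
    then show ?thesis unfolding par_def by (metis (no_types, lifting) the1_equality theI')
  qed
  then show ?thesis using in_arcsD2 by blast
qed

lemma par_in_verts: "v \<in> pverts G \<Longrightarrow> par G v \<in> pverts G"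
  using arc_iff_par in_arcsD1 by blast

lemma iterated_par_in_verts: "v \<in> pverts G \<Longrightarrow> (par G ^^ n) v \<in> pverts G"
  by (induction n) (auto simp: par_in_verts)

lemma reachable_iff_iterated_par:
  "a \<rightarrow>\<^sup>*\<^bsub>with_proj G\<^esub> v \<longleftrightarrow> v \<in> pverts G \<and> (\<exists>n. (par G ^^ n) v = a)"
proof
  assume "a \<rightarrow>\<^sup>*\<^bsub>with_proj G\<^esub> v"
  then have "(a, v) \<in> rtrancl_on (pverts G) (parcs G)" by (simp add: reachable_def)
  then show "v \<in> pverts G \<and> (\<exists>n. (par G ^^ n) v = a)"
  proof (induction rule: rtrancl_on_induct)
    case base
    then show ?case by (auto intro: exI[of _ 0])
  next
    case (step y z)
    then obtain n where "(par G ^^ n) (par G z) = a" by (auto simp: arc_iff_par)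
    then have "(par G ^^ Suc n) z = a" by (simp add: funpow_swap1)
    then show ?case using step by blast
  qed
next
  have "((par G ^^ n) v, v) \<in> rtrancl_on (pverts G) (parcs G)" if "v \<in> pverts G" for n
  proof (induction n)
    case (Suc n)
    have "((par G ^^ Suc n) v, (par G ^^ n) v) \<in> parcs G"
      using that by (simp add: arc_iff_par iterated_par_in_verts)
    then show ?case
      using Suc iterated_par_in_verts[OF that] by (rule converse_rtrancl_on_into_rtrancl_on)
  qed (use that in auto)
  then show "v \<in> pverts G \<and> (\<exists>n. (par G ^^ n) v = a) \<Longrightarrow> a \<rightarrow>\<^sup>*\<^bsub>with_proj G\<^esub> v"
    by (auto simp: reachable_def)
qed

lemma not_closed_w: "\<not> closed_w p"
  using closed_w_imp_cycle no_circuits by blast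

text \<open>A vertex that recurs among its own iterated parents would close up a directed walk, and every
  closed walk contains a cycle.\<close>

lemma iterated_par_no_period:
  assumes "v \<in> pverts G" "(par G ^^ n) v = v"
  shows "n = 0"
proof (rule ccontr)
  assume "n \<noteq> 0"
  then obtain m where n: "n = Suc m" by (cases n) auto
  have "((par G ^^ Suc k) v, v) \<in> (parcs G)\<^sup>+" for k
  proof (induction k)
    case 0
    then show ?case using assms(1) by (auto simp: arc_iff_par)
  next
    case (Suc k)
    have "((par G ^^ Suc (Suc k)) v, (par G ^^ Suc k) v) \<in> parcs G"
      using assms(1) by (simp add: arc_iff_par iterated_par_in_verts par_in_verts)
    with Suc show ?case by (meson trancl_into_trancl2)
  qed
  from this[of m] have "(v, v) \<in> (parcs G)\<^sup>+" using assms n by simp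
  then obtain p where "awalk v p v" "p \<noteq> []" using reachable1_awalk by auto
  then show False using not_closed_w[of p] by (auto simp: closed_w_def)
qed

lemma iterated_par_inj:
  assumes "v \<in> pverts G" "(par G ^^ m) v = (par G ^^ n) v"
  shows "m = n"
proof -
  have "m = n" if "m \<le> n" "(par G ^^ m) v = (par G ^^ n) v" for m n
  proof -
    have "(par G ^^ (n - m)) ((par G ^^ m) v) = (par G ^^ m) v"
      using funpow_diff[OF that(1), of "par G" v] that(2) by simp
    then have "n - m = 0" using iterated_par_no_period iterated_par_in_verts[OF assms(1)] by blast
    with that show ?thesis by simp
  qed
  with assms(2) show ?thesis by (metis nle_le)
qed

lemma in_Des_iff: "v \<in> Des G a \<longleftrightarrow> v \<in> pverts G \<and> (\<exists>n. (par G ^^ n) v = a)"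
  by (auto simp: Des_def reachable_iff_iterated_par)

lemma Des_subset: "Des G a \<subseteq> pverts G"
  by (auto simp: Des_def)

lemma Des_root_in_verts: "v \<in> Des G a \<Longrightarrow> a \<in> pverts G"
  by (auto simp: in_Des_iff iterated_par_in_verts)

lemma in_Des_iterated_par: "v \<in> pverts G \<Longrightarrow> v \<in> Des G ((par G ^^ n) v)"
  by (auto simp: in_Des_iff)

lemma Des_refl: "v \<in> pverts G \<Longrightarrow> v \<in> Des G v"
  using in_Des_iterated_par[of v 0] by simp

lemma in_Des_par: "v \<in> pverts G \<Longrightarrow> v \<in> Des G (par G v)"
  using in_Des_iterated_par[of v 1] by simp

lemma Des_trans:
  assumes "v \<in> Des G w" "w \<in> Des G a"
  shows "v \<in> Des G a"
proof -
  obtain m n where "(par G ^^ n) v = w" "(par G ^^ m) w = a" "v \<in> pverts G"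
    using assms unfolding in_Des_iff by blast
  then have "(par G ^^ (m + n)) v = a" by (simp add: funpow_add)
  with \<open>v \<in> pverts G\<close> show ?thesis unfolding in_Des_iff by blast
qed

lemma Des_antisym:
  assumes "v \<in> Des G w" "w \<in> Des G v"
  shows "v = w"
proof -
  obtain m n where mn: "(par G ^^ n) v = w" "(par G ^^ m) w = v" "v \<in> pverts G"
    using assms unfolding in_Des_iff by blast
  then have "(par G ^^ (m + n)) v = v" by (simp add: funpow_add)
  with mn(3) have "m + n = 0" by (rule iterated_par_no_period)
  with mn show ?thesis by simp
qed

text \<open>Parents are unique, so the ancestors of a vertex lie on one chain, obtained by iterating the
  parent map. Together with reflexivity, transitivity and antisymmetry this is all that the join
  computations below use of the tree.\<close>

lemma ancestors_comparable:
  assumes "v \<in> Des G a" "v \<in> Des G c"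
  shows "a \<in> Des G c \<or> c \<in> Des G a"
proof -
  obtain m n where mn: "(par G ^^ n) v = a" "(par G ^^ m) v = c" "v \<in> pverts G"
    using assms unfolding in_Des_iff by blast
  have "(par G ^^ (m - n)) a = c \<or> (par G ^^ (n - m)) c = a"
    using mn(1,2) funpow_diff[of n m "par G" v] funpow_diff[of m n "par G" v]
    by (cases "n \<le> m") auto
  then show ?thesis using assms Des_root_in_verts unfolding in_Des_iff by blast
qed

lemma in_Asc_iff:
  assumes "v \<in> pverts G"
  shows "a \<in> Asc G v \<longleftrightarrow> v \<in> Des G a \<and> a \<noteq> v"
proof -
  have "n \<ge> 1 \<longleftrightarrow> (par G ^^ n) v \<noteq> v" for n
    using iterated_par_no_period[OF assms, of n] by (cases "n = 0") auto
  then show ?thesis using assms unfolding Asc_def in_Des_iff by auto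
qed

text \<open>The vertices of the path from \<open>a\<close> to \<open>v\<close> form an order interval: a walk from \<open>a\<close> to \<open>w\<close>
  followed by one from \<open>w\<close> to \<open>v\<close> is already a path.\<close>

lemma path_verts_eq: "path_verts G a v = {w \<in> Des G a. v \<in> Des G w}"
proof (intro equalityI subsetI)
  fix w assume "w \<in> path_verts G a v"
  then obtain p where "apath a p v" "w \<in> set (pawalk_verts a p)"
    by (auto simp: path_verts_def awalk_verts_with_proj_eq)
  then have "a \<rightarrow>\<^sup>*\<^bsub>with_proj G\<^esub> w" "w \<rightarrow>\<^sup>*\<^bsub>with_proj G\<^esub> v"
    using awalk_verts_reachable_from awalk_verts_reachable_to by (auto simp: apath_def)
  then show "w \<in> {w \<in> Des G a. v \<in> Des G w}"
    by (auto simp: in_Des_iff reachable_iff_iterated_par)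
next
  fix w assume "w \<in> {w \<in> Des G a. v \<in> Des G w}"
  then have "a \<rightarrow>\<^sup>*\<^bsub>with_proj G\<^esub> w" "w \<rightarrow>\<^sup>*\<^bsub>with_proj G\<^esub> v"
    by (auto simp: Des_def)
  then obtain p q where pq: "awalk a p w" "awalk w q v"
    by (auto simp: reachable_awalk)
  then have walk: "awalk a (p @ q) v" by simp
  \<comment> \<open>A repeated vertex would cut out a closed walk, so this walk is a path.\<close>
  have "distinct (pawalk_verts a (p @ q))"
    using awalk_not_distinct_decomp[OF walk] not_closed_w by (auto simp: closed_w_def)
  then have "apath a (p @ q) v" using walk by (simp add: apath_def)
  moreover have "w \<in> set (pawalk_verts a (p @ q))"
    using pq hd_in_awalk_verts(1)[OF pq(2)] by (simp add: set_awalk_verts_append[OF pq])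
  ultimately show "w \<in> path_verts G a v"
    by (auto simp: path_verts_def awalk_verts_with_proj_eq)
qed

lemma tree_le_iff: "tree_le G (Some a) (Some v) \<longleftrightarrow> v \<in> Des G a"
proof
  have "x \<in> Des G a"
    if "(Some a, y) \<in> rtrancl_on (pverts (ext_tree G)) (parcs (ext_tree G))" "y = Some x" for x y
    using that
  proof (induction arbitrary: x rule: rtrancl_on_induct)
    case base
    then show ?case by (auto simp: ext_tree_def intro: Des_refl)
  next
    \<comment> \<open>The vertex at infinity has no outgoing arc, so a path that ends in the tree never meets it.\<close>
    case (step y z)
    then obtain y' where y: "y = Some y'" "(y', x) \<in> parcs G"
      by (auto simp: ext_tree_def)
    then have "x \<in> Des G y'"
      using in_Des_par by (simp add: arc_iff_par)
    with step.IH[OF y(1)] show ?case using Des_trans by blast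
  qed
  moreover assume "tree_le G (Some a) (Some v)"
  ultimately show "v \<in> Des G a"
    by (simp add: tree_le_def reachable_def)
next
  assume "v \<in> Des G a"
  then have "(a, v) \<in> rtrancl_on (pverts G) (parcs G)"
    by (simp add: Des_def reachable_def)
  then have "(Some a, Some v) \<in> rtrancl_on (pverts (ext_tree G)) (parcs (ext_tree G))"
    by (induction rule: rtrancl_on_induct)
      (auto simp: ext_tree_def intro: rtrancl_on_into_rtrancl_on)
  then show "tree_le G (Some a) (Some v)"
    by (simp add: tree_le_def reachable_def)
qed

lemma common_anc_eq:
  "x \<in> pverts G \<Longrightarrow> y \<in> pverts G \<Longrightarrow> common_anc G x y = {w. x \<in> Des G w \<and> y \<in> Des G w}"
  unfolding common_anc_def in_Des_iff using iterated_par_in_verts[of x]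
  by (intro Collect_cong) metis

lemma tree_meet_eqI:
  assumes "x \<in> Des G w" "y \<in> Des G w"
    and max: "\<And>w'. x \<in> Des G w' \<Longrightarrow> y \<in> Des G w' \<Longrightarrow> w \<in> Des G w'"
  shows "tree_meet G (Some x) (Some y) = Some w"
proof -
  have "x \<in> pverts G" "y \<in> pverts G" using assms Des_subset by auto
  then show ?thesis
    using assms by (auto simp: tree_meet_def common_anc_eq tree_le_iff intro!: the_equality
        intro: Des_antisym)
qed

text \<open>Connectedness ignores orientation, so it has to be turned into an upward statement: the ancestors
  of \<open>x\<close> are followed along an undirected walk to \<open>y\<close>. A step to a child keeps a common ancestor; a
  step to a parent keeps it or replaces it by that parent, by comparability.\<close>

lemma common_ancestor_exists:
  assumes "x \<in> pverts G" "y \<in> pverts G"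
  obtains w where "x \<in> Des G w" "y \<in> Des G w"
proof -
  have "(x, y) \<in> rtrancl_on (pverts G) (parcs (mk_symmetric (with_proj G)))"
    using weakly_connected assms
    by (auto simp: connected_def strongly_connected_def reachable_def)
  then have "\<exists>w. x \<in> Des G w \<and> y \<in> Des G w"
  proof (induction rule: rtrancl_on_induct)
    case base
    then show ?case using Des_refl by blast
  next
    case (step y z)
    then obtain w where w: "x \<in> Des G w" "y \<in> Des G w" by blast
    from step have "y = par G z \<or> z = par G y"
      by (auto simp: parcs_mk_symmetric arc_iff_par)
    then show ?case
    proof
      assume "y = par G z"
      then have "z \<in> Des G y" using step in_Des_par by simp
      with w show ?thesis using Des_trans by blast
    next
      assume z: "z = par G y"
      then have "y \<in> Des G z" using step in_Des_par by simp
      with w(2) have "w \<in> Des G z \<or> z \<in> Des G w" by (rule ancestors_comparable)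
      with w step show ?thesis using Des_trans Des_refl by blast
    qed
  qed
  with that show ?thesis by blast
qed

end


section \<open>Square summable functions on disjoint blocks\<close>

definition restr :: "'a set \<Rightarrow> ('a \<Rightarrow> complex) \<Rightarrow> ('a \<Rightarrow> complex)" where
  "restr A f = (\<lambda>v. if v \<in> A then f v else 0)"

text \<open>Square summability passes to pointwise dominated functions, in particular to restrictions.\<close>

lemma l2_dominated:
  assumes "g \<in> l2 B" "\<And>v. cmod (f v) \<le> cmod (g v)" "\<And>v. v \<notin> A \<Longrightarrow> f v = 0"
  shows "f \<in> l2 A"
proof -
  have "(\<lambda>v. (cmod (f v))\<^sup>2) summable_on UNIV"
    by (rule summable_on_comparison_test[where f = "\<lambda>v. (cmod (g v))\<^sup>2"])
      (use assms(1,2) in \<open>auto simp: l2_def power_mono\<close>)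
  with assms(3) show ?thesis by (auto simp: l2_def)
qed

lemma restr_in_l2: "f \<in> l2 B \<Longrightarrow> restr A f \<in> l2 A"
  by (rule l2_dominated) (auto simp: restr_def)

lemma finite_support_in_l2: "finite A \<Longrightarrow> (\<And>v. v \<notin> A \<Longrightarrow> f v = 0) \<Longrightarrow> f \<in> l2 A"
  using summable_on_cong_neutral[of UNIV A "\<lambda>v. (cmod (f v))\<^sup>2" "\<lambda>v. (cmod (f v))\<^sup>2"]
  by (simp add: l2_def summable_on_finite)

lemma l2_add:
  assumes "f \<in> l2 A" "g \<in> l2 A"
  shows "f + g \<in> l2 A"
proof -
  have "(cmod (f v + g v))\<^sup>2 \<le> 2 * (cmod (f v))\<^sup>2 + 2 * (cmod (g v))\<^sup>2" for v
  proof -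
    have "(cmod (f v + g v))\<^sup>2 \<le> (cmod (f v) + cmod (g v))\<^sup>2"
      by (intro power_mono norm_triangle_ineq) auto
    also have "\<dots> \<le> 2 * (cmod (f v))\<^sup>2 + 2 * (cmod (g v))\<^sup>2"
      using sum_squares_bound[of "cmod (f v)" "cmod (g v)"] by (simp add: power2_sum)
    finally show ?thesis .
  qed
  note bound = this
  have "(\<lambda>v. (cmod (f v + g v))\<^sup>2) summable_on UNIV"
    by (rule summable_on_comparison_test[where f = "\<lambda>v. 2 * (cmod (f v))\<^sup>2 + 2 * (cmod (g v))\<^sup>2"])
      (use assms bound in \<open>auto simp: l2_def intro!: summable_on_add summable_on_cmult_right\<close>)
  with assms show ?thesis by (auto simp: l2_def)
qed

lemma l2_cscale: "f \<in> l2 A \<Longrightarrow> cscale c f \<in> l2 A"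
  by (auto simp: l2_def cscale_def norm_mult power_mult_distrib intro: summable_on_cmult_right)

lemma l2_mono: "A \<subseteq> B \<Longrightarrow> f \<in> l2 A \<Longrightarrow> f \<in> l2 B"
  by (auto simp: l2_def)

lemma l2_subspace: "cfun.subspace (l2 A)"
  by (rule cfun.subspaceI) (auto intro: l2_add l2_cscale, simp add: l2_def)

lemma l2_norm_power2: "(l2_norm f)\<^sup>2 = (\<Sum>\<^sub>\<infinity>v. (cmod (f v))\<^sup>2)"
  by (simp add: l2_norm_def infsum_nonneg)

lemma l2_norm_nonneg: "0 \<le> l2_norm f"
  by (simp add: l2_norm_def infsum_nonneg)

lemma cmod_le_l2_norm:
  assumes "f \<in> l2 A"
  shows "cmod (f v) \<le> l2_norm f"
proof -
  have "(cmod (f v))\<^sup>2 \<le> (l2_norm f)\<^sup>2"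
    using finite_sum_le_infsum[of "\<lambda>v. (cmod (f v))\<^sup>2" UNIV "{v}"] assms
    by (simp add: l2_norm_power2 l2_def)
  then show ?thesis by (rule power2_le_imp_le[OF _ l2_norm_nonneg])
qed

text \<open>Outside a large finite set a function of \<open>l2\<close> has small norm. The bound is stated for all
  functions dominated by \<open>f\<close> that vanish on the finite set, so that it applies both to tails of a
  block decomposition and to truncations.\<close>

lemma l2_small_tail:
  assumes f: "f \<in> l2 A" and "e > 0"
  obtains W where "finite W"
    "\<And>g. (\<And>v. cmod (g v) \<le> cmod (f v)) \<Longrightarrow> (\<And>v. v \<in> W \<Longrightarrow> g v = 0) \<Longrightarrow> l2_norm g < e"
proof -
  let ?f = "\<lambda>v. (cmod (f v))\<^sup>2"
  have sf: "?f summable_on B" for B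
    using f by (auto simp: l2_def intro: summable_on_subset_banach)
  obtain W where W: "finite W" "dist (sum ?f W) (infsum ?f UNIV) \<le> e\<^sup>2 / 2"
    using infsum_finite_approximation[OF sf, of "e\<^sup>2 / 2" UNIV] \<open>e > 0\<close> by auto
  have "l2_norm g < e" if g: "\<And>v. cmod (g v) \<le> cmod (f v)" "\<And>v. v \<in> W \<Longrightarrow> g v = 0" for g
  proof -
    have "g \<in> l2 UNIV" using f g(1) by (rule l2_dominated) auto
    then have "(l2_norm g)\<^sup>2 \<le> infsum ?f (- W)"
      unfolding l2_norm_power2 using g sf
      by (intro infsum_mono_neutral) (auto simp: l2_def power_mono)
    also have "\<dots> = infsum ?f UNIV - sum ?f W"
      using infsum_Un_disjoint[of ?f W "- W"] sf W(1) by simp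
    also have "\<dots> < e\<^sup>2"
    proof -
      have "infsum ?f UNIV - sum ?f W \<le> e\<^sup>2 / 2"
        using W(2) unfolding dist_real_def by linarith
      moreover have "0 < e\<^sup>2" using \<open>e > 0\<close> by simp
      ultimately show ?thesis by linarith
    qed
    finally show ?thesis by (rule power2_less_imp_less) (use \<open>e > 0\<close> in simp)
  qed
  with W(1) that show ?thesis by blast
qed

lemma sum_fun_apply: "(\<Sum>j\<in>S. F j) v = (\<Sum>j\<in>S. F j v)"
  by (induction S rule: infinite_finite_induct) auto

lemma sum_disjoint_supports_apply:
  assumes "disjoint_family_on A J" "\<And>j. j \<in> J \<Longrightarrow> F j \<in> l2 (A j)"
    and "finite S" "S \<subseteq> J" "j \<in> J" "v \<in> A j"
  shows "(\<Sum>i\<in>S. F i) v = (if j \<in> S then F j v else 0)"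
proof -
  have "F i v = (if i = j then F j v else 0)" if "i \<in> S" for i
  proof (cases "i = j")
    case False
    have "v \<notin> A i"
      using disjoint_family_onD[OF assms(1) _ assms(5) False] assms(4,6) that by blast
    then show ?thesis using False assms(2,4) that by (auto simp: l2_def)
  qed simp
  then have "(\<Sum>i\<in>S. F i) v = (\<Sum>i\<in>S. if i = j then F j v else 0)"
    unfolding sum_fun_apply by (rule sum.cong[OF refl])
  with assms(3) show ?thesis by simp
qed

text \<open>Norm convergence implies pointwise convergence, and at any point at most one summand is nonzero;
  hence a norm convergent sum over disjoint supports determines its summands as restrictions of
  the limit. Conversely, only finitely many blocks meet a finite set that carries almost all of the
  norm of \<open>f\<close>, so the sum of the restrictions of \<open>f\<close> converges.\<close>

lemma l2_has_sum_disjoint: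
  assumes disj: "disjoint_family_on A J" and F: "\<And>j. j \<in> J \<Longrightarrow> F j \<in> l2 (A j)"
  shows "l2_has_sum F J f \<longleftrightarrow> f \<in> l2 (\<Union>j\<in>J. A j) \<and> (\<forall>j\<in>J. F j = restr (A j) f)"
proof
  assume sums: "l2_has_sum F J f"
  then have f: "f \<in> l2 UNIV" by (simp add: l2_has_sum_def)
  \<comment> \<open>At a fixed point the remainders are eventually constant, and they are bounded by norms that
    tend to zero.\<close>
  have limit0: "c = 0" if ev: "\<And>S. finite S \<Longrightarrow> S \<subseteq> J \<Longrightarrow> B \<subseteq> S \<Longrightarrow> (f - (\<Sum>j\<in>S. F j)) v = c"
    and B: "finite B" "B \<subseteq> J" for v c B
  proof -
    have "\<forall>\<^sub>F S in finite_subsets_at_top J. norm c \<le> l2_norm (f - (\<Sum>j\<in>S. F j))"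
      unfolding eventually_finite_subsets_at_top
    proof (intro exI[of _ B] conjI allI impI)
      fix S assume S: "finite S \<and> B \<subseteq> S \<and> S \<subseteq> J"
      have "F j \<in> l2 UNIV" if "j \<in> S" for j using F S that by (auto simp: l2_def)
      then have "(\<Sum>j\<in>S. F j) \<in> l2 UNIV" by (rule cfun.subspace_sum[OF l2_subspace])
      then have "f - (\<Sum>j\<in>S. F j) \<in> l2 UNIV"
        using f cfun.subspace_diff[OF l2_subspace] by blast
      then show "norm c \<le> l2_norm (f - (\<Sum>j\<in>S. F j))"
        using cmod_le_l2_norm[of _ UNIV v] ev S by metis
    qed (use B in auto)
    then have "((\<lambda>S. c) \<longlongrightarrow> 0) (finite_subsets_at_top J)"
      using sums by (auto simp: l2_has_sum_def intro: Lim_null_comparison)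
    then show "c = 0" by (simp add: tendsto_const_iff)
  qed
  have off: "f v = 0" if v: "v \<notin> (\<Union>j\<in>J. A j)" for v
  proof (rule limit0[where B = "{}"])
    fix S assume "finite S" "S \<subseteq> J"
    then have "\<forall>j\<in>S. F j v = 0" using v F by (auto simp: l2_def)
    then have "(\<Sum>j\<in>S. F j) v = 0" by (simp add: sum_fun_apply)
    then show "(f - (\<Sum>j\<in>S. F j)) v = f v" by simp
  qed auto
  have on: "f v - F j v = 0" if j: "j \<in> J" and v: "v \<in> A j" for j v
  proof (rule limit0[where B = "{j}"])
    fix S assume "finite S" "S \<subseteq> J" "{j} \<subseteq> S"
    then show "(f - (\<Sum>j\<in>S. F j)) v = f v - F j v"
      using sum_disjoint_supports_apply[OF disj F] j v by simp
  qed (use j in auto)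
  have "F j = restr (A j) f" if j: "j \<in> J" for j
  proof
    fix v show "F j v = restr (A j) f v"
      using on[OF j, of v] F[OF j] by (auto simp: restr_def l2_def)
  qed
  with f off show "f \<in> l2 (\<Union>j\<in>J. A j) \<and> (\<forall>j\<in>J. F j = restr (A j) f)"
    by (auto simp: l2_def)
next
  assume asm: "f \<in> l2 (\<Union>j\<in>J. A j) \<and> (\<forall>j\<in>J. F j = restr (A j) f)"
  have "\<forall>\<^sub>F S in finite_subsets_at_top J. dist (l2_norm (f - (\<Sum>j\<in>S. F j))) 0 < e" if "e > 0" for e
  proof -
    obtain W where W: "finite W"
      "\<And>g. (\<And>v. cmod (g v) \<le> cmod (f v)) \<Longrightarrow> (\<And>v. v \<in> W \<Longrightarrow> g v = 0) \<Longrightarrow> l2_norm g < e"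
      using l2_small_tail asm \<open>e > 0\<close> by blast
    \<comment> \<open>Only the blocks that meet \<open>W\<close> have to be summed, and each point of \<open>W\<close> meets at most one.\<close>
    define S0 where "S0 = (\<Union>w\<in>W. {j \<in> J. w \<in> A j})"
    have "finite {j \<in> J. w \<in> A j}" for w
    proof (cases "\<exists>j\<in>J. w \<in> A j")
      case True
      then obtain j where "j \<in> J" "w \<in> A j" by blast
      then have "{j \<in> J. w \<in> A j} \<subseteq> {j}" using disj by (auto simp: disjoint_family_on_def)
      then show ?thesis using finite_subset by blast
    next
      case False
      then have "{j \<in> J. w \<in> A j} = {}" by blast
      then show ?thesis by (simp only: finite.emptyI)
    qed
    then have "finite S0" using W(1) by (simp add: S0_def)
    show ?thesis
      unfolding eventually_finite_subsets_at_top
    proof (intro exI[of _ S0] conjI allI impI)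
      fix S assume S: "finite S \<and> S0 \<subseteq> S \<and> S \<subseteq> J"
      have val: "(f - (\<Sum>j\<in>S. F j)) v = (if \<exists>j\<in>S. v \<in> A j then 0 else f v)" for v
      proof (cases "\<exists>j\<in>J. v \<in> A j")
        case True
        then obtain j where j: "j \<in> J" "v \<in> A j" by blast
        then have "(\<exists>j\<in>S. v \<in> A j) \<longleftrightarrow> j \<in> S"
          using disjoint_family_onD[OF disj, of j] S by blast
        then show ?thesis
          using sum_disjoint_supports_apply[OF disj F _ _ j, of S] S j asm
          by (simp add: restr_def)
      next
        case False
        then have "\<forall>j\<in>S. F j v = 0" using S F by (auto simp: l2_def)
        then have "(\<Sum>j\<in>S. F j) v = 0" by (simp add: sum_fun_apply)
        then show ?thesis using False S by auto
      qed
      have "l2_norm (f - (\<Sum>j\<in>S. F j)) < e"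
      proof (rule W(2))
        fix v assume v: "v \<in> W"
        have "f v = 0" if "\<forall>j\<in>S. v \<notin> A j"
        proof -
          have "v \<notin> A j" if "j \<in> J" for j
            using v S \<open>\<forall>j\<in>S. v \<notin> A j\<close> \<open>j \<in> J\<close> by (auto simp: S0_def)
          then show ?thesis using asm by (auto simp: l2_def)
        qed
        then show "(f - (\<Sum>j\<in>S. F j)) v = 0" unfolding val by auto
      next
        fix v show "cmod ((f - (\<Sum>j\<in>S. F j)) v) \<le> cmod (f v)"
          unfolding val by simp
      qed
      then show "dist (l2_norm (f - (\<Sum>j\<in>S. F j))) 0 < e" by (simp add: l2_norm_nonneg)
    qed (use \<open>finite S0\<close> S0_def in auto)
  qed
  then show "l2_has_sum F J f"
    using asm unfolding l2_has_sum_def by (intro conjI tendstoI) (auto simp: l2_def)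
qed

lemma l2_orthogonal_decomposition:
  assumes "disjoint_family_on A J"
  shows "orthogonal_decomposition (l2 (\<Union>j\<in>J. A j)) J (\<lambda>j. l2 (A j))"
proof -
  have "l2_inner f g = 0" if "i \<in> J" "j \<in> J" "i \<noteq> j" "f \<in> l2 (A i)" "g \<in> l2 (A j)" for i j f g
  proof -
    have "f v * cnj (g v) = 0" for v
    proof (cases "v \<in> A i")
      case True
      then have "v \<notin> A j" using disjoint_family_onD[OF assms that(1-3)] by blast
      then show ?thesis using that by (simp add: l2_def)
    qed (use that in \<open>simp add: l2_def\<close>)
    then show ?thesis unfolding l2_inner_def by (intro infsum_0)
  qed
  moreover have "l2 (\<Union>j\<in>J. A j) = {f. \<exists>F. (\<forall>j\<in>J. F j \<in> l2 (A j)) \<and> l2_has_sum F J f}"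
  proof (intro equalityI subsetI)
    fix f assume f: "f \<in> l2 (\<Union>j\<in>J. A j)"
    then have "\<forall>j\<in>J. restr (A j) f \<in> l2 (A j)" by (blast intro: restr_in_l2)
    with f have "l2_has_sum (\<lambda>j. restr (A j) f) J f"
      using l2_has_sum_disjoint[OF assms, of "\<lambda>j. restr (A j) f" f] by blast
    with \<open>\<forall>j\<in>J. _\<close> show "f \<in> {f. \<exists>F. (\<forall>j\<in>J. F j \<in> l2 (A j)) \<and> l2_has_sum F J f}" by auto
  qed (use l2_has_sum_disjoint[OF assms] in blast)
  moreover have "l2 (A j) \<subseteq> l2 (\<Union>j\<in>J. A j)" if "j \<in> J" for j
    using that by (auto simp: l2_def)
  ultimately show ?thesis
    using l2_subspace by (auto simp: orthogonal_decomposition_def)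
qed

lemma indicator_in_l2: "u \<in> A \<Longrightarrow> indicator {u} \<in> l2 A"
  using finite_support_in_l2[of "{u}" "indicator {u}"] by (auto simp: l2_def indicator_eq_0_iff)

text \<open>Testing against the unit vectors of the points of \<open>A\<close> shows that orthogonality to \<open>l2 A\<close> means
  vanishing on \<open>A\<close>.\<close>

lemma orth_compl_l2:
  assumes "A \<subseteq> V"
  shows "orth_compl (l2 V) (l2 A) = l2 (V - A)"
proof (intro equalityI subsetI)
  fix f assume f: "f \<in> orth_compl (l2 V) (l2 A)"
  have "f v = 0" if "v \<in> A" for v
  proof -
    have "l2_inner f (indicator {v}) = (\<Sum>\<^sub>\<infinity>w\<in>{v}. f w)"
      unfolding l2_inner_def by (rule infsum_cong_neutral) auto
    then show ?thesis using f indicator_in_l2[OF that] by (simp add: orth_compl_def)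
  qed
  with f show "f \<in> l2 (V - A)" by (auto simp: orth_compl_def l2_def)
next
  fix f assume f: "f \<in> l2 (V - A)"
  have "l2_inner f h = 0" if "h \<in> l2 A" for h
  proof -
    have "f v * cnj (h v) = 0" for v using f that by (cases "v \<in> A") (auto simp: l2_def)
    then show ?thesis unfolding l2_inner_def by (intro infsum_0)
  qed
  with f show "f \<in> orth_compl (l2 V) (l2 A)" by (auto simp: orth_compl_def l2_def)
qed

text \<open>Square summability may be checked blockwise, by summing the nonnegative squares over each block
  first. This translates the summability condition in the domain of a direct sum.\<close>

lemma l2_iff_blocks:
  assumes disj: "disjoint_family_on A J" and off: "\<And>v. v \<notin> (\<Union>j\<in>J. A j) \<Longrightarrow> g v = 0"
  shows "g \<in> l2 (\<Union>j\<in>J. A j) \<longleftrightarrow>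
    (\<forall>j\<in>J. restr (A j) g \<in> l2 (A j)) \<and> (\<lambda>j. (l2_norm (restr (A j) g))\<^sup>2) summable_on J"
proof -
  let ?h = "\<lambda>v. (cmod (g v))\<^sup>2"
  have block: "restr (A j) g \<in> l2 (A j) \<longleftrightarrow> ?h summable_on A j" for j
    using summable_on_cong_neutral[of UNIV "A j" "\<lambda>v. (cmod (restr (A j) g v))\<^sup>2" ?h]
    by (auto simp: l2_def restr_def)
  have norm_block: "(l2_norm (restr (A j) g))\<^sup>2 = infsum ?h (A j)" for j
    unfolding l2_norm_power2 by (rule infsum_cong_neutral) (auto simp: restr_def)
  have bij: "bij_betw snd (Sigma J A) (\<Union>j\<in>J. A j)"
  proof (rule bij_betw_imageI)
    show "inj_on snd (Sigma J A)"
    proof (rule inj_onI)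
      fix x y assume xy: "x \<in> Sigma J A" "y \<in> Sigma J A" "snd x = snd y"
      then have "fst x = fst y"
        using disjoint_family_onD[OF disj, of "fst x" "fst y"] by (cases x, cases y) auto
      with xy(3) show "x = y" by (simp add: prod_eq_iff)
    qed
  qed (simp add: snd_image_Sigma)
  have "g \<in> l2 (\<Union>j\<in>J. A j) \<longleftrightarrow> ?h summable_on (\<Union>j\<in>J. A j)"
    using off summable_on_cong_neutral[of "\<Union>j\<in>J. A j" UNIV ?h ?h] by (auto simp: l2_def)
  also have "\<dots> \<longleftrightarrow> (\<lambda>x. ?h (snd x)) summable_on Sigma J A"
    using summable_on_reindex_bij_betw[OF bij, of ?h] by simp
  also have "\<dots> \<longleftrightarrow> (\<forall>j\<in>J. ?h summable_on A j) \<and> (\<lambda>j. infsum ?h (A j)) summable_on J"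
    using Infinite_Sum.abs_summable_on_Sigma_iff[where f = "\<lambda>x. ?h (snd x)" and A = J and B = A] by (simp add: infsum_nonneg)
  finally show ?thesis unfolding block norm_block .
qed


section \<open>Direct sums of operators on disjoint blocks\<close>

text \<open>A criterion for an operator to be a direct sum. The operator is given by a formula \<open>M\<close> on all
  functions, and each \<open>T j\<close> computes the part of \<open>M f\<close> in the block \<open>A j\<close> from the part of \<open>f\<close> in that
  block. If the domain consists of the \<open>f\<close> whose parts lie in the domains of the \<open>T j\<close> and for which
  \<open>M f\<close> is square summable, then these conditions are those that define the direct sum, since a
  vector of the direct sum is determined by its parts.\<close>

lemma direct_sum_by_blocks:
  fixes T :: "'i \<Rightarrow> 'a l2_op"
  assumes disj: "disjoint_family_on A J"
    and domT: "\<And>j. j \<in> J \<Longrightarrow> dom (T j) \<subseteq> l2 (A j)"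
    and ranT: "\<And>j. j \<in> J \<Longrightarrow> ran (T j) \<subseteq> l2 (A j)"
    and off: "\<And>f v. v \<notin> (\<Union>j\<in>J. A j) \<Longrightarrow> M f v = 0"
    and blocks: "\<And>f j. f \<in> l2 (\<Union>j\<in>J. A j) \<Longrightarrow> j \<in> J \<Longrightarrow> restr (A j) f \<in> dom (T j) \<Longrightarrow>
      T j (restr (A j) f) = Some (restr (A j) (M f))"
    and W: "\<And>f. W f = (if f \<in> l2 (\<Union>j\<in>J. A j) \<and> (\<forall>j\<in>J. restr (A j) f \<in> dom (T j)) \<and>
      M f \<in> l2 (\<Union>j\<in>J. A j) then Some (M f) else None)"
  shows "dom W = direct_sum_dom J T" and "W = direct_sum J T"
proof -
  let ?U = "\<Union>j\<in>J. A j"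
  have sum_iff: "(\<forall>j\<in>J. F j \<in> dom (T j)) \<and> l2_has_sum F J f \<longleftrightarrow>
      f \<in> l2 ?U \<and> (\<forall>j\<in>J. restr (A j) f \<in> dom (T j)) \<and> (\<forall>j\<in>J. F j = restr (A j) f)" for F f
  proof (cases "\<forall>j\<in>J. F j \<in> dom (T j)")
    case True
    with domT have "F j \<in> l2 (A j)" if "j \<in> J" for j using that by blast
    with True show ?thesis using l2_has_sum_disjoint[OF disj, of F f] by auto
  qed auto
  have M_l2: "M f \<in> l2 ?U \<longleftrightarrow> (\<lambda>j. (l2_norm (the (T j (restr (A j) f))))\<^sup>2) summable_on J"
    if f: "f \<in> l2 ?U" "\<forall>j\<in>J. restr (A j) f \<in> dom (T j)" for f
  proof -
    have "restr (A j) (M f) \<in> l2 (A j)" if "j \<in> J" for j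
      using ranT[OF that] blocks[OF f(1) that] f(2) that by (auto simp: ran_def)
    then show ?thesis
      using l2_iff_blocks[of A J "M f", OF disj off] blocks[OF f(1)] f(2)
        summable_on_cong[of J "\<lambda>j. (l2_norm (the (T j (restr (A j) f))))\<^sup>2"
          "\<lambda>j. (l2_norm (restr (A j) (M f)))\<^sup>2"] by auto
  qed
  have dom_iff: "f \<in> direct_sum_dom J T \<longleftrightarrow>
      f \<in> l2 ?U \<and> (\<forall>j\<in>J. restr (A j) f \<in> dom (T j)) \<and> M f \<in> l2 ?U" for f
  proof
    assume "f \<in> direct_sum_dom J T"
    then obtain F where "(\<forall>j\<in>J. F j \<in> dom (T j)) \<and> l2_has_sum F J f"
      and S: "(\<lambda>j. (l2_norm (the (T j (F j))))\<^sup>2) summable_on J"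
      unfolding direct_sum_dom_def by blast
    then have f: "f \<in> l2 ?U" "\<forall>j\<in>J. restr (A j) f \<in> dom (T j)" "\<forall>j\<in>J. F j = restr (A j) f"
      using sum_iff by blast+
    have "(\<lambda>j. (l2_norm (the (T j (restr (A j) f))))\<^sup>2) summable_on J \<longleftrightarrow>
        (\<lambda>j. (l2_norm (the (T j (F j))))\<^sup>2) summable_on J"
      using f(3) by (intro summable_on_cong) simp
    with S have "M f \<in> l2 ?U" using M_l2[OF f(1,2)] by simp
    with f(1,2) show "f \<in> l2 ?U \<and> (\<forall>j\<in>J. restr (A j) f \<in> dom (T j)) \<and> M f \<in> l2 ?U" by simp
  next
    assume f: "f \<in> l2 ?U \<and> (\<forall>j\<in>J. restr (A j) f \<in> dom (T j)) \<and> M f \<in> l2 ?U"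
    then have "l2_has_sum (\<lambda>j. restr (A j) f) J f"
      using sum_iff[of "\<lambda>j. restr (A j) f" f] by blast
    moreover have "(\<lambda>j. (l2_norm (the (T j (restr (A j) f))))\<^sup>2) summable_on J"
      using f M_l2[of f] by simp
    ultimately show "f \<in> direct_sum_dom J T"
      unfolding direct_sum_dom_def using f by (intro CollectI exI[of _ "\<lambda>j. restr (A j) f"]) simp
  qed
  show "dom W = direct_sum_dom J T"
    using dom_iff W by (auto simp: dom_def)
  have "W f = direct_sum J T f" for f
  proof (cases "f \<in> direct_sum_dom J T")
    case True
    then have f: "f \<in> l2 ?U" "\<forall>j\<in>J. restr (A j) f \<in> dom (T j)" "M f \<in> l2 ?U"
      using dom_iff by blast+
    have T_l2: "the (T j (restr (A j) f)) \<in> l2 (A j)" if "j \<in> J" for j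
      using ranT[OF that] blocks[OF f(1) that] f(2) that by (auto simp: ran_def)
    have glue: "l2_has_sum (\<lambda>j. the (T j (F j))) J g \<longleftrightarrow> g = M f"
      if F: "\<forall>j\<in>J. F j = restr (A j) f" for F g
    proof -
      have TF: "the (T j (F j)) = restr (A j) (M f)" if "j \<in> J" for j
        using F blocks[OF f(1) that] f(2) that by auto
      have "l2_has_sum (\<lambda>j. the (T j (F j))) J g \<longleftrightarrow>
          g \<in> l2 ?U \<and> (\<forall>j\<in>J. restr (A j) (M f) = restr (A j) g)"
        using l2_has_sum_disjoint[OF disj, of "\<lambda>j. the (T j (F j))" g] T_l2 F TF by auto
      also have "\<dots> \<longleftrightarrow> g = M f"
      proof
        assume g: "g \<in> l2 ?U \<and> (\<forall>j\<in>J. restr (A j) (M f) = restr (A j) g)"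
        show "g = M f"
        proof
          fix v show "g v = M f v"
          proof (cases "v \<in> ?U")
            case True
            then obtain j where j: "j \<in> J" "v \<in> A j" by blast
            then have "restr (A j) (M f) v = restr (A j) g v" using g by simp
            with j show ?thesis by (simp add: restr_def)
          next
            case False
            then show ?thesis using g off by (auto simp: l2_def)
          qed
        qed
      qed (use f in auto)
      finally show ?thesis .
    qed
    have "(\<exists>F. (\<forall>j\<in>J. F j \<in> dom (T j)) \<and> l2_has_sum F J f \<and>
        l2_has_sum (\<lambda>j. the (T j (F j))) J g) \<longleftrightarrow> g = M f" for g
    proof
      assume "g = M f"
      then have "l2_has_sum (\<lambda>j. the (T j (restr (A j) f))) J g"
        using glue[of "\<lambda>j. restr (A j) f" g] by simp
      with f show "\<exists>F. (\<forall>j\<in>J. F j \<in> dom (T j)) \<and> l2_has_sum F J f \<and>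
          l2_has_sum (\<lambda>j. the (T j (F j))) J g"
        using sum_iff[of "\<lambda>j. restr (A j) f" f]
        by (intro exI[of _ "\<lambda>j. restr (A j) f"]) simp
    next
      assume "\<exists>F. (\<forall>j\<in>J. F j \<in> dom (T j)) \<and> l2_has_sum F J f \<and>
          l2_has_sum (\<lambda>j. the (T j (F j))) J g"
      then obtain F where F: "(\<forall>j\<in>J. F j \<in> dom (T j)) \<and> l2_has_sum F J f"
        "l2_has_sum (\<lambda>j. the (T j (F j))) J g"
        by (elim exE conjE) simp
      then show "g = M f" using sum_iff[of F f] glue[of F g] by simp
    qed
    with True W[of f] f show ?thesis by (simp add: direct_sum_def)
  next
    case False
    with dom_iff W[of f] show ?thesis by (auto simp: direct_sum_def)
  qed
  then show "W = direct_sum J T" ..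
qed


section \<open>Diagonal and rank-one operators\<close>

text \<open>Truncations to finite sets approximate in norm.\<close>

lemma densely_defined_in_l2I:
  assumes "dom T \<subseteq> l2 A"
    and fin: "\<And>f W. f \<in> l2 A \<Longrightarrow> finite W \<Longrightarrow> restr W f \<in> dom T"
  shows "densely_defined_in (l2 A) T"
  unfolding densely_defined_in_def
proof (intro conjI ballI allI impI)
  fix f :: "'a \<Rightarrow> complex" and e :: real
  assume f: "f \<in> l2 A" and "e > 0"
  obtain W where W: "finite W"
    "\<And>g. (\<And>v. cmod (g v) \<le> cmod (f v)) \<Longrightarrow> (\<And>v. v \<in> W \<Longrightarrow> g v = 0) \<Longrightarrow> l2_norm g < e"
    using l2_small_tail f \<open>e > 0\<close> by blast
  have "l2_norm (f - restr W f) < e" by (rule W(2)) (auto simp: restr_def)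
  with fin[OF f W(1)] show "\<exists>g\<in>dom T. l2_norm (f - g) < e" by blast
qed (use assms in auto)

lemma linear_operator_in_oslash:
  assumes H: "cfun.subspace H" and x: "x \<in> H"
  shows "linear_operator_in H (oslash H J x g)"
proof -
  let ?T = "oslash H J x g" and ?s = "\<lambda>h j. h j * cnj (g j)"
  have dom: "dom ?T = {h \<in> H. ?s h summable_on J}"
    by (auto simp: oslash_def dom_def)
  have "0 \<in> dom ?T" using cfun.subspace_0[OF H] by (simp add: dom)
  moreover have add: "h + k \<in> dom ?T \<and> the (?T (h + k)) = the (?T h) + the (?T k)"
    if hk: "h \<in> dom ?T" "k \<in> dom ?T" for h k
  proof -
    have s: "?s (h + k) = (\<lambda>j. ?s h j + ?s k j)" by (simp add: fun_eq_iff algebra_simps)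
    have "h + k \<in> dom ?T"
      using hk cfun.subspace_add[OF H] unfolding dom by (simp add: s summable_on_add del: plus_fun_apply)
    moreover have "infsum (?s (h + k)) J = infsum (?s h) J + infsum (?s k) J"
      unfolding s using hk by (intro infsum_add) (auto simp: dom)
    ultimately show ?thesis
      using hk unfolding dom by (simp add: oslash_def cfun.scale_left_distrib del: plus_fun_apply)
  qed
  moreover have scale: "cscale c h \<in> dom ?T \<and> the (?T (cscale c h)) = cscale c (the (?T h))"
    if h: "h \<in> dom ?T" for c h
  proof -
    have s: "?s (cscale c h) = (\<lambda>j. c * ?s h j)" by (simp add: fun_eq_iff cscale_def)
    have "cscale c h \<in> dom ?T"
      using h cfun.subspace_scale[OF H] unfolding dom by (simp add: s summable_on_cmult_right)
    moreover have "infsum (?s (cscale c h)) J = c * infsum (?s h) J"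
      unfolding s by (rule infsum_cmult_right')
    ultimately show ?thesis using h unfolding dom by (simp add: oslash_def)
  qed
  moreover have "ran ?T \<subseteq> H"
    using cfun.subspace_scale[OF H x] by (auto simp: oslash_def ran_def split: if_splits)
  moreover have "dom ?T \<subseteq> H" by (auto simp: dom)
  ultimately show ?thesis
    unfolding linear_operator_in_def cfun.subspace_def by blast
qed

text \<open>The range of a linear operator is a subspace, so inside a line it is the line or zero.\<close>

lemma rank_at_most_one:
  assumes T: "linear_operator_in H T" and x: "ran T \<subseteq> cfun.span {x}"
  shows "rank_at_most 1 T"
proof -
  have ran: "ran T = (\<lambda>f. the (T f)) ` dom T" by (force simp: ran_def dom_def)
  have sub: "cfun.subspace (dom T)" using T by (simp add: linear_operator_in_def)
  have scale: "cscale c y \<in> ran T" if y: "y \<in> ran T" for c y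
  proof -
    obtain f where f: "f \<in> dom T" "y = the (T f)" using y unfolding ran by blast
    then have "cscale c f \<in> dom T" "the (T (cscale c f)) = cscale c y"
      using T cfun.subspace_scale[OF sub] by (auto simp: linear_operator_in_def)
    then show ?thesis unfolding ran by (metis imageI)
  qed
  obtain y0 where "y0 \<in> ran T" using cfun.subspace_0[OF sub] ran by blast
  then have "0 \<in> ran T" using scale[of y0 0] by simp
  show ?thesis
  proof (cases "ran T = {0}")
    case True
    then show ?thesis
      unfolding rank_at_most_def by (intro exI[of _ "{}"]) (auto simp: cfun.independent_empty)
  next
    case False
    then obtain y where y: "y \<in> ran T" "y \<noteq> 0" using \<open>0 \<in> ran T\<close> by blast
    then obtain c where c: "y = cscale c x" using x by (auto simp: cfun.span_singleton)
    with y have "c \<noteq> 0" by auto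
    with c have "x = cscale (1 / c) y" by simp
    then have "x \<in> cfun.span {y}" by (auto simp: cfun.span_singleton)
    then have "cfun.span {x} \<subseteq> cfun.span {y}" by (intro cfun.span_minimal) auto
    with x have "ran T \<subseteq> cfun.span {y}" by blast
    moreover have "cfun.span {y} \<subseteq> ran T" using scale y by (auto simp: cfun.span_singleton)
    ultimately show ?thesis
      unfolding rank_at_most_def using y(2)
      by (intro exI[of _ "{y}"]) auto
  qed
qed

lemma finite_support_in_dom_oslash:
  assumes "f \<in> l2 A" "finite W" "\<And>v. v \<notin> W \<Longrightarrow> f v = 0"
  shows "f \<in> dom (oslash (l2 A) J x g)"
proof -
  have "(\<lambda>j. f j * cnj (g j)) summable_on (J \<inter> W)"
    using assms(2) by (intro summable_on_finite) simp
  also have "?this \<longleftrightarrow> (\<lambda>j. f j * cnj (g j)) summable_on J"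
    using assms(3) by (intro summable_on_cong_neutral) auto
  finally show ?thesis using assms(1) by (simp add: oslash_def domIff)
qed

lemma densely_defined_in_oslash: "densely_defined_in (l2 A) (oslash (l2 A) J x g)"
proof (rule densely_defined_in_l2I)
  show "dom (oslash (l2 A) J x g) \<subseteq> l2 A" by (auto simp: oslash_def split: if_splits)
next
  fix f W assume f: "f \<in> l2 A" and "finite (W :: 'a set)"
  have "restr W f \<in> l2 A"
    using f by (rule l2_dominated) (use f in \<open>auto simp: restr_def l2_def\<close>)
  then show "restr W f \<in> dom (oslash (l2 A) J x g)"
    using \<open>finite W\<close> by (rule finite_support_in_dom_oslash) (simp add: restr_def)
qed

lemma rank_at_most_one_oslash:
  assumes "cfun.subspace H" "x \<in> H"
  shows "rank_at_most 1 (oslash H J x g)"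
proof (rule rank_at_most_one[OF linear_operator_in_oslash[OF assms]])
  show "ran (oslash H J x g) \<subseteq> cfun.span {x}"
    by (auto simp: oslash_def ran_def cfun.span_singleton split: if_splits)
qed

text \<open>Multiples of a unit vector have finite support, so the functional converges on the range.\<close>

lemma invariant_domain_oslash_indicator:
  assumes "u \<in> A"
  shows "invariant_domain (oslash (l2 A) J (indicator {u}) g)"
proof -
  have "cscale c (indicator {u}) \<in> dom (oslash (l2 A) J (indicator {u}) g)" for c
    by (rule finite_support_in_dom_oslash[of _ _ "{u}"])
      (auto simp: cscale_def indicator_eq_0_iff intro: l2_cscale[unfolded cscale_def] indicator_in_l2[OF assms])
  then show ?thesis
    by (auto simp: invariant_domain_def oslash_def ran_def split: if_splits)
qed

text \<open>The functional of the rank-one operator, evaluated at the part of \<open>f\<close> in a block, is the sum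
  that defines the weighted join: the conjugations in the weight vector and in the operator cancel.\<close>

lemma oslash_weight_vec_block:
  assumes "f \<in> l2 B" "R \<subseteq> A" "R \<subseteq> V"
  shows "oslash (l2 A) V x (weight_vec lam R) (restr A f) =
    (if (\<lambda>v. lam (Some v) * f v) summable_on R
     then Some (cscale (\<Sum>\<^sub>\<infinity>v\<in>R. lam (Some v) * f v) x) else None)"
proof -
  let ?s = "\<lambda>v. restr A f v * cnj (weight_vec lam R v)"
  have "?s summable_on V \<longleftrightarrow> (\<lambda>v. lam (Some v) * f v) summable_on R"
    using assms(2,3) by (intro summable_on_cong_neutral) (auto simp: weight_vec_def restr_def)
  moreover have "infsum ?s V = (\<Sum>\<^sub>\<infinity>v\<in>R. lam (Some v) * f v)"
    using assms(2,3) by (intro infsum_cong_neutral) (auto simp: weight_vec_def restr_def)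
  ultimately show ?thesis using restr_in_l2[OF assms(1)] by (simp add: oslash_def)
qed

text \<open>The domain condition of a diagonal operator says that the image is square summable.\<close>

lemma diag_op_eq:
  "diag_op A \<mu> f = (if f \<in> l2 A \<and> (\<lambda>v. \<mu> v * f v) \<in> l2 A then Some (\<lambda>v. \<mu> v * f v) else None)"
proof -
  have "(\<lambda>v. (cmod (\<mu> v))\<^sup>2 * (cmod (f v))\<^sup>2) summable_on A \<longleftrightarrow> (\<lambda>v. \<mu> v * f v) \<in> l2 A"
    if "f \<in> l2 A"
  proof -
    have "(\<lambda>v. (cmod (\<mu> v))\<^sup>2 * (cmod (f v))\<^sup>2) summable_on A \<longleftrightarrow>
        (\<lambda>v. (cmod (\<mu> v * f v))\<^sup>2) summable_on UNIV"
      using that by (intro summable_on_cong_neutral) (auto simp: l2_def norm_mult power_mult_distrib)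
    with that show ?thesis by (simp add: l2_def)
  qed
  then show ?thesis by (auto simp: diag_op_def)
qed

lemma dom_ran_diag_op: "dom (diag_op A \<mu>) \<subseteq> l2 A" "ran (diag_op A \<mu>) \<subseteq> l2 A"
  by (auto simp: diag_op_eq dom_def ran_def split: if_splits)

lemma densely_defined_in_diag_op: "densely_defined_in (l2 A) (diag_op A \<mu>)"
proof (rule densely_defined_in_l2I[OF dom_ran_diag_op(1)])
  fix f W assume f: "f \<in> l2 A" and "finite (W :: 'a set)"
  have "h \<in> l2 A" if "\<And>v. v \<notin> A \<inter> W \<Longrightarrow> h v = 0" for h
    using finite_support_in_l2[of "A \<inter> W" h] that \<open>finite W\<close> by (auto intro: l2_mono[of "A \<inter> W" A])
  note supp = this
  have "restr W f \<in> l2 A" "(\<lambda>v. \<mu> v * restr W f v) \<in> l2 A"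
    by (rule supp; use f in \<open>auto simp: restr_def l2_def\<close>)+
  then show "restr W f \<in> dom (diag_op A \<mu>)" by (simp add: diag_op_eq domIff)
qed

lemma diag_op_restrict:
  assumes "A \<subseteq> B"
  shows "diag_op B \<mu> |` l2 A = diag_op A \<mu>"
proof
  fix f
  have "(\<lambda>v. \<mu> v * f v) \<in> l2 B \<longleftrightarrow> (\<lambda>v. \<mu> v * f v) \<in> l2 A" "f \<in> l2 B" if "f \<in> l2 A"
    using that assms by (auto simp: l2_def)
  then show "(diag_op B \<mu> |` l2 A) f = diag_op A \<mu> f"
    by (auto simp: restrict_map_def diag_op_eq)
qed


section \<open>Joins with a fixed vertex\<close>

context rootless_directed_tree
begin

lemma diag_verts_subset: "u \<in> pverts G \<Longrightarrow> diag_verts G b u \<subseteq> pverts G"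
  using Des_subset Des_root_in_verts
  by (auto simp: diag_verts_def Des_off_def in_Asc_iff split: if_splits)

lemma root_not_diag_vert: "u \<in> pverts G \<Longrightarrow> u \<notin> diag_verts G b u"
  by (auto simp: diag_verts_def Des_off_def in_Asc_iff path_verts_eq Des_refl)

text \<open>The rank-one part acts on vertices outside the diagonal part, which is what makes the two parts
  act in orthogonal subspaces.\<close>

lemma rank_one_verts_subset:
  assumes "u \<in> pverts G" "b \<in> pverts G"
  shows "rank_one_verts G b u \<subseteq> pverts G - diag_verts G b u"
proof (cases "b \<in> Des G u")
  case True
  then show ?thesis
    using assms Des_subset
    by (auto simp: rank_one_verts_def diag_verts_def Des_off_def in_Asc_iff path_verts_eq
        dest: Des_antisym)
next
  case False
  then show ?thesis
    using assms Des_root_in_verts Des_antisym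
    by (auto simp: rank_one_verts_def diag_verts_def Des_off_def in_Asc_iff path_verts_eq)
qed

text \<open>The whole join table at a finite base point: the join with \<open>u\<close> fixes the diagonal vertices, sends
  the rank-one vertices to \<open>u\<close>, and sends all others to infinity, where they no longer contribute.
  If \<open>b\<close> is a descendant of \<open>u\<close>, then \<open>u\<close> is an ancestor of \<open>b\<close>, and the ancestors of \<open>b\<close> are joined by
  the meet, which compares them inside one chain; otherwise only the order join occurs.\<close>

lemma join_at_vertex:
  assumes u: "u \<in> pverts G" and b: "b \<in> pverts G" and "u \<noteq> b" and v: "v \<in> pverts G"
  shows "join_at G (Some b) (Some u) (Some v) =
    (if v \<in> diag_verts G b u then Some v else if v \<in> rank_one_verts G b u then Some u else None)"
proof (cases "b \<in> Des G u")
  case True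
  then have u_Asc: "u \<in> Asc G b" using in_Asc_iff \<open>u \<noteq> b\<close> b by blast
  show ?thesis
  proof (cases "v \<in> Asc G b")
    case vb: True
    then have vD: "b \<in> Des G v" "v \<noteq> b" using in_Asc_iff b by auto
    from vD(1) True have "v \<in> Des G u \<or> u \<in> Des G v" by (rule ancestors_comparable)
    then show ?thesis
    proof
      assume vu: "v \<in> Des G u"
      then have "tree_meet G (Some u) (Some v) = Some u"
        by (intro tree_meet_eqI) (auto simp: Des_refl u)
      with vu True vD u_Asc vb u show ?thesis
        by (auto simp: join_at_def Asc_ext_def diag_verts_def rank_one_verts_def Des_off_def
            path_verts_eq in_Asc_iff dest: Des_antisym)
    next
      assume uv: "u \<in> Des G v"
      then have "tree_meet G (Some u) (Some v) = Some v"
        by (intro tree_meet_eqI) (auto simp: Des_refl v)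
      with uv True vD u_Asc vb u show ?thesis
        by (auto simp: join_at_def Asc_ext_def diag_verts_def rank_one_verts_def Des_off_def
            path_verts_eq in_Asc_iff Des_refl dest: Des_antisym)
    qed
  next
    case vb: False
    then have vD: "b \<in> Des G v \<longleftrightarrow> v = b" using in_Asc_iff b Des_refl by blast
    then have "u \<notin> Des G v" using True Des_trans Des_antisym \<open>u \<noteq> b\<close> by blast
    with True vD vb u \<open>u \<noteq> b\<close> show ?thesis
      by (auto simp: join_at_def Asc_ext_def diag_verts_def rank_one_verts_def Des_off_def
            path_verts_eq in_Asc_iff tree_join_def tree_le_iff)
  qed
next
  case False
  then have "u \<notin> Asc G b" using in_Asc_iff b by blast
  moreover have "u \<in> Des G u" using Des_refl u by blast
  moreover have "u \<in> Des G v \<Longrightarrow> v \<in> Des G u \<Longrightarrow> v = u" using Des_antisym by blast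
  ultimately show ?thesis
    using False u \<open>u \<noteq> b\<close>
    by (auto simp: join_at_def Asc_ext_def diag_verts_def rank_one_verts_def Des_off_def
            path_verts_eq in_Asc_iff tree_join_def tree_le_iff)
qed

lemma in_layer_imp_anc: "v \<in> layer G u j \<Longrightarrow> v \<in> Des G ((par G ^^ j) u)"
  by (simp add: layer_def)

lemma ancestor_chain:
  assumes "u \<in> pverts G" "i \<le> j"
  shows "(par G ^^ i) u \<in> Des G ((par G ^^ j) u)"
proof -
  have "(par G ^^ (j - i)) ((par G ^^ i) u) = (par G ^^ j) u"
    using assms(2) by (rule funpow_diff)
  then show ?thesis using iterated_par_in_verts[OF assms(1)] unfolding in_Des_iff by blast
qed

text \<open>The descendant sets of the iterated parents increase and exhaust the tree, and the index of the
  layer of \<open>v\<close> is the first one at which \<open>v\<close> appears.\<close>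

lemma in_layer_iff:
  assumes "u \<in> pverts G"
  shows "v \<in> layer G u j \<longleftrightarrow> (\<forall>k. v \<in> Des G ((par G ^^ k) u) \<longleftrightarrow> j \<le> k)"
proof
  assume v: "v \<in> layer G u j"
  show "\<forall>k. v \<in> Des G ((par G ^^ k) u) \<longleftrightarrow> j \<le> k"
  proof (intro allI iffI)
    fix k assume vk: "v \<in> Des G ((par G ^^ k) u)"
    show "j \<le> k"
    proof (rule ccontr)
      assume "\<not> j \<le> k"
      then have "v \<in> Des G ((par G ^^ (j - 1)) u)" "j \<noteq> 0"
        using Des_trans[OF vk ancestor_chain[OF assms, of k "j - 1"]] by auto
      with v show False by (simp add: layer_def)
    qed
  next
    fix k assume "j \<le> k"
    with v show "v \<in> Des G ((par G ^^ k) u)"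
      using Des_trans ancestor_chain[OF assms] in_layer_imp_anc by blast
  qed
qed (auto simp: layer_def)

lemma layer_disjoint: "u \<in> pverts G \<Longrightarrow> disjoint_family (layer G u)"
  by (auto simp: disjoint_family_on_def in_layer_iff) (meson le_refl order_antisym)

lemma layer_UN: 
  assumes "u \<in> pverts G"
  shows "(\<Union>j. layer G u j) = pverts G"
proof (intro equalityI subsetI)
  fix v assume v: "v \<in> pverts G"
  obtain w where "u \<in> Des G w" "v \<in> Des G w" using common_ancestor_exists assms v by blast
  then have ex: "\<exists>k. v \<in> Des G ((par G ^^ k) u)" by (auto simp: in_Des_iff)
  define j where "j = (LEAST k. v \<in> Des G ((par G ^^ k) u))"
  have "v \<in> layer G u j"
    using LeastI_ex[OF ex] not_less_Least[of "j - 1" "\<lambda>k. v \<in> Des G ((par G ^^ k) u)"]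
    by (auto simp: layer_def j_def)
  then show "v \<in> (\<Union>j. layer G u j)" by blast
qed (use Des_subset in \<open>auto simp: layer_def\<close>)

text \<open>Every common ancestor of \<open>u\<close> and \<open>v\<close> is an iterated parent of \<open>u\<close>, and the lowest of them that
  lies above \<open>v\<close> is the one that indexes the layer of \<open>v\<close>.\<close>

lemma join_at_infinity:
  assumes "u \<in> pverts G" "v \<in> layer G u j"
  shows "join_at G None (Some u) (Some v) = Some ((par G ^^ j) u)"
proof -
  have "tree_meet G (Some u) (Some v) = Some ((par G ^^ j) u)"
  proof (rule tree_meet_eqI)
    show "u \<in> Des G ((par G ^^ j) u)" using ancestor_chain[OF assms(1), of 0 j] by simp
    show "v \<in> Des G ((par G ^^ j) u)" using assms(2) by (rule in_layer_imp_anc)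
    fix w assume "u \<in> Des G w" "v \<in> Des G w"
    then show "(par G ^^ j) u \<in> Des G w"
      using assms ancestor_chain by (auto simp: in_Des_iff[of u] in_layer_iff)
  qed
  moreover have "v \<in> pverts G" using layer_UN assms by blast
  ultimately show ?thesis using assms by (simp add: join_at_def Asc_ext_def)
qed


section \<open>Decomposition of weighted join operators\<close>

lemma join_preimage_vertex:
  assumes u: "u \<in> pverts G" and b: "b \<in> pverts G" and "u \<noteq> b"
  shows "join_preimage G (Some b) u w =
    (if w \<in> diag_verts G b u then {w} else if w = u then rank_one_verts G b u else {})"
  using diag_verts_subset[OF u, of b] root_not_diag_vert[OF u, of b] rank_one_verts_subset[OF u b]
    join_at_vertex[OF assms]
  unfolding join_preimage_def by (auto split: if_splits)

text \<open>Distinct iterated parents are distinct vertices, so every layer is a full fibre of the join.\<close>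

lemma join_preimage_infinity:
  assumes u: "u \<in> pverts G"
  shows "join_preimage G None u ((par G ^^ j) u) = layer G u j"
    and "w \<notin> range (\<lambda>j. (par G ^^ j) u) \<Longrightarrow> join_preimage G None u w = {}"
proof -
  have "v \<in> join_preimage G None u w \<longleftrightarrow> (\<exists>i. v \<in> layer G u i \<and> w = (par G ^^ i) u)" for v w
  proof
    assume v: "v \<in> join_preimage G None u w"
    then obtain i where i: "v \<in> layer G u i" using layer_UN[OF u] by (auto simp: join_preimage_def)
    with v join_at_infinity[OF u i] show "\<exists>i. v \<in> layer G u i \<and> w = (par G ^^ i) u"
      by (auto simp: join_preimage_def)
  next
    assume "\<exists>i. v \<in> layer G u i \<and> w = (par G ^^ i) u"
    then show "v \<in> join_preimage G None u w"
      using layer_UN[OF u] join_at_infinity[OF u] by (auto simp: join_preimage_def)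
  qed
  then show "join_preimage G None u ((par G ^^ j) u) = layer G u j"
    "w \<notin> range (\<lambda>j. (par G ^^ j) u) \<Longrightarrow> join_preimage G None u w = {}"
    using iterated_par_inj[OF u] by blast+
qed

text \<open>By the join table, the value of the weighted join at a diagonal vertex is a single term, its value
  at \<open>u\<close> is the sum over the rank-one vertices, and it vanishes elsewhere. So the two blocks do not
  interact.\<close>

lemma weighted_join_vertex:
  assumes u: "u \<in> pverts G" and b: "b \<in> pverts G" and "u \<noteq> b"
  shows "weighted_join G (Some b) u lam =
    direct_sum2 (diag_op (diag_verts G b u) (\<lambda>v. lam (Some v)))
      (oslash (l2 (pverts G - diag_verts G b u)) (pverts G) (indicator {u})
        (weight_vec lam (rank_one_verts G b u)))"
proof -
  define V A R where "V = pverts G" and "A = diag_verts G b u" and "R = rank_one_verts G b u"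
  let ?D = "diag_op A (\<lambda>v. lam (Some v))"
  let ?N = "oslash (l2 (V - A)) V (indicator {u}) (weight_vec lam R)"
  let ?M = "join_map G (Some b) u lam"
  let ?B = "case_bool A (V - A)" and ?T = "case_bool ?D ?N"
  have A: "A \<subseteq> V" "u \<notin> A" and R: "R \<subseteq> V - A" and uV: "u \<in> V"
    using diag_verts_subset root_not_diag_vert rank_one_verts_subset u b
    by (auto simp: V_def A_def R_def)
  have pre: "join_preimage G (Some b) u w = (if w \<in> A then {w} else if w = u then R else {})" for w
    using join_preimage_vertex[OF assms] by (simp add: A_def R_def)
  have M: "?M f w = (if w \<in> A then lam (Some w) * f w
      else if w = u then \<Sum>\<^sub>\<infinity>v\<in>R. lam (Some v) * f v else 0)" for f w
    using A uV by (auto simp: join_map_def pre V_def)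
  have U: "(\<Union>i. ?B i) = V" using A by (auto simp: UNIV_bool)
  have ind: "indicator {u} \<in> l2 (V - A)" using uV A by (intro indicator_in_l2) auto
  \<comment> \<open>Each block operator returns the part of the join formula in its block; its domain
    condition is convergence of one series, or square summability of that part.\<close>
  have N_eq: "?N (restr (V - A) f) = (if (\<lambda>v. lam (Some v) * f v) summable_on R
      then Some (restr (V - A) (?M f)) else None)" if "f \<in> l2 V" for f
  proof -
    have "cscale (\<Sum>\<^sub>\<infinity>v\<in>R. lam (Some v) * f v) (indicator {u}) = restr (V - A) (?M f)"
      using uV A by (auto simp: fun_eq_iff cscale_def restr_def M indicator_def)
    moreover have "R \<subseteq> V" using R by blast
    ultimately show ?thesis using oslash_weight_vec_block[OF that R, of V] by simp
  qed
  have D_eq: "?D (restr A f) = (if restr A (?M f) \<in> l2 A then Some (restr A (?M f)) else None)"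
    if "f \<in> l2 V" for f
  proof -
    have "(\<lambda>v. lam (Some v) * restr A f v) = restr A (?M f)"
      by (auto simp: fun_eq_iff restr_def M)
    then show ?thesis using restr_in_l2[OF that, of A] by (simp add: diag_op_eq)
  qed
  have "weighted_join G (Some b) u lam = direct_sum UNIV ?T"
  proof (rule direct_sum_by_blocks(2)[where A = ?B and M = ?M])
    show "disjoint_family ?B"
      by (auto simp: disjoint_family_on_def split: bool.splits)
    have N: "dom ?N \<subseteq> l2 (V - A)" "ran ?N \<subseteq> l2 (V - A)"
      using linear_operator_in_oslash[OF l2_subspace ind] by (auto simp: linear_operator_in_def)
    show "dom (?T i) \<subseteq> l2 (?B i)" for i
      using N(1) dom_ran_diag_op(1) by (cases i) simp_all
    show "ran (?T i) \<subseteq> l2 (?B i)" for i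
      using N(2) dom_ran_diag_op(2) by (cases i) simp_all
    show "?M f v = 0" if "v \<notin> (\<Union>i. ?B i)" for f v
      using that by (simp add: U join_map_def V_def)
    show "?T i (restr (?B i) f) = Some (restr (?B i) (?M f))"
      if "f \<in> l2 (\<Union>i. ?B i)" "restr (?B i) f \<in> dom (?T i)" for f i
      using that N_eq[of f] D_eq[of f] unfolding U
      by (cases i) (auto simp: domIff split: if_splits)
    show "weighted_join G (Some b) u lam f =
        (if f \<in> l2 (\<Union>i. ?B i) \<and> (\<forall>i\<in>UNIV. restr (?B i) f \<in> dom (?T i)) \<and> ?M f \<in> l2 (\<Union>i. ?B i)
         then Some (?M f) else None)" for f
    proof (cases "f \<in> l2 V \<and> ?M f \<in> l2 V")
      case True
      have "(\<forall>w\<in>V. (\<lambda>v. lam (Some v) * f v) summable_on join_preimage G (Some b) u w) \<longleftrightarrow>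
          (\<lambda>v. lam (Some v) * f v) summable_on R"
        unfolding pre using uV A by (auto simp: summable_on_finite)
      moreover have "restr A (?M f) \<in> l2 A" using True restr_in_l2 by blast
      ultimately show ?thesis
        using True N_eq[of f] D_eq[of f] unfolding U weighted_join_def V_def[symmetric]
        by (simp add: UNIV_bool domIff)
    next
      case False
      then show ?thesis unfolding U weighted_join_def V_def[symmetric] by auto
    qed
  qed
  then show ?thesis by (simp add: V_def A_def R_def)
qed

text \<open>The fibre of the join over the \<open>j\<close>-fold parent of \<open>u\<close> is the \<open>j\<close>-th layer, and that parent itself
  lies in the layer. So the weighted join maps every layer to one unit vector of the same layer.\<close>

lemma weighted_join_infinity:
  fixes lam :: "'a option \<Rightarrow> complex"
  defines "T \<equiv> \<lambda>u j. oslash (l2 (layer G u j)) (pverts G) (indicator {(par G ^^ j) u})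
    (weight_vec lam (layer G u j))"
  assumes u: "u \<in> pverts G"
  shows "dom (weighted_join G None u lam) = direct_sum_dom UNIV (T u)"
    and "weighted_join G None u lam = direct_sum UNIV (T u)"
    and "linear_operator_in (l2 (layer G u j)) (T u j)"
proof -
  let ?M = "join_map G None u lam" and ?u = "\<lambda>j. (par G ^^ j) u" and ?A = "layer G u"
  \<comment> \<open>An iterated parent is not its own proper descendant, so it enters exactly at its own layer.\<close>
  have u_layer: "?u j \<in> ?A j" for j
  proof -
    have "?u j \<notin> Des G (?u (j - 1))" if "j \<noteq> 0"
    proof
      assume "?u j \<in> Des G (?u (j - 1))"
      then have "?u j = ?u (j - 1)" using ancestor_chain[OF u, of "j - 1" j] Des_antisym by simp
      then show False using iterated_par_inj[OF u, of j "j - 1"] that by simp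
    qed
    then show ?thesis using ancestor_chain[OF u, of j j] by (simp add: layer_def)
  qed
  show linear: "linear_operator_in (l2 (?A j)) (T u j)" for j
    unfolding T_def by (intro linear_operator_in_oslash l2_subspace indicator_in_l2 u_layer)
  have layer_subset: "?A j \<subseteq> pverts G" for j using layer_UN[OF u] by blast
  have M: "restr (?A j) (?M f) =
      cscale (\<Sum>\<^sub>\<infinity>v\<in>?A j. lam (Some v) * f v) (indicator {?u j})" for f j
  proof
    fix w
    show "restr (?A j) (?M f) w =
      cscale (\<Sum>\<^sub>\<infinity>v\<in>?A j. lam (Some v) * f v) (indicator {?u j}) w"
    proof (cases "w = ?u j")
      case True
      then show ?thesis
        using u_layer[of j] iterated_par_in_verts[OF u, of j]
        by (simp add: restr_def cscale_def join_map_def join_preimage_infinity(1)[OF u])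
    next
      case False
      have "?M f w = 0" if w: "w \<in> ?A j"
      proof -
        have "w \<noteq> ?u i" for i
          using disjoint_family_onD[OF layer_disjoint[OF u], of i j] u_layer[of i] False w by auto
        then show ?thesis using join_preimage_infinity(2)[OF u, of w] by (simp add: join_map_def image_iff)
      qed
      with False show ?thesis by (simp add: restr_def cscale_def)
    qed
  qed
  have T_eq: "T u j (restr (?A j) f) = (if (\<lambda>v. lam (Some v) * f v) summable_on ?A j
      then Some (restr (?A j) (?M f)) else None)" if "f \<in> l2 (pverts G)" for f j
    unfolding T_def M using oslash_weight_vec_block[OF that subset_refl layer_subset] .
  have W: "weighted_join G None u lam f = (if f \<in> l2 (\<Union>j. ?A j) \<and>
      (\<forall>j\<in>UNIV. restr (?A j) f \<in> dom (T u j)) \<and> ?M f \<in> l2 (\<Union>j. ?A j) then Some (?M f) else None)" for f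
  proof (cases "f \<in> l2 (pverts G)")
    case True
    have "(\<forall>w\<in>pverts G. (\<lambda>v. lam (Some v) * f v) summable_on join_preimage G None u w) \<longleftrightarrow>
        (\<forall>j. (\<lambda>v. lam (Some v) * f v) summable_on ?A j)"
    proof (intro iffI allI ballI)
      fix j assume "\<forall>w\<in>pverts G. (\<lambda>v. lam (Some v) * f v) summable_on join_preimage G None u w"
      then show "(\<lambda>v. lam (Some v) * f v) summable_on ?A j"
        using iterated_par_in_verts[OF u, of j] join_preimage_infinity(1)[OF u, of j] by metis
    next
      fix w assume "\<forall>j. (\<lambda>v. lam (Some v) * f v) summable_on ?A j"
      then show "(\<lambda>v. lam (Some v) * f v) summable_on join_preimage G None u w"
        using join_preimage_infinity[OF u] by (cases "w \<in> range ?u") auto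
    qed
    with True show ?thesis
      unfolding layer_UN[OF u] weighted_join_def by (auto simp: T_eq domIff)
  qed (simp add: layer_UN[OF u] weighted_join_def)
  have blocks: "T u j (restr (?A j) f) = Some (restr (?A j) (?M f))"
    if "f \<in> l2 (\<Union>j. ?A j)" "restr (?A j) f \<in> dom (T u j)" for f j
    using that T_eq[of f j] unfolding layer_UN[OF u] by (auto simp: domIff split: if_splits)
  have off: "?M f v = 0" if "v \<notin> (\<Union>j. ?A j)" for f v
    using that unfolding layer_UN[OF u] by (simp add: join_map_def)
  have dom_ran: "dom (T u j) \<subseteq> l2 (?A j)" "ran (T u j) \<subseteq> l2 (?A j)" for j
    using linear by (auto simp: linear_operator_in_def)
  note sum = direct_sum_by_blocks[where A = ?A and J = UNIV and M = ?M and T = "T u"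
      and W = "weighted_join G None u lam", OF layer_disjoint[OF u] dom_ran off blocks W]
  show "dom (weighted_join G None u lam) = direct_sum_dom UNIV (T u)"
    by (rule sum(1))
  show "weighted_join G None u lam = direct_sum UNIV (T u)"
    by (rule sum(2))
qed

end

theorem theorem6p6:
  fixes G :: "'a pair_pre_digraph" and b :: "'a option" and u :: 'a
    and lam :: "'a option \<Rightarrow> complex"
  assumes "rootless_directed_tree G"
    and "countable (pverts G)" and "infinite (pverts G)"
    and "b \<in> pverts (ext_tree G)"
    and "u \<in> pverts G" and "Some u \<noteq> b"
    and "lam None = 0"
  shows
    "(\<forall>b'. b = Some b' \<longrightarrow>
       (let H = l2 (diag_verts G b' u);
            K = orth_compl (l2 (pverts G)) H
        in orthogonal_decomposition2 (l2 (pverts G)) H K \<and>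
           (\<exists>D N. weighted_join G b u lam = direct_sum2 D N \<and>
              diagonal_operator_in (diag_verts G b' u) D \<and> densely_defined_in H D \<and>
              linear_operator_in K N \<and> densely_defined_in K N \<and>
              rank_at_most 1 N \<and> invariant_domain N \<and>
              D = weight_diag G lam |` H \<and>
              dom D = {f \<in> H. f \<in> dom (weight_diag G lam) \<and> the (weight_diag G lam f) \<in> H} \<and>
              N = oslash K (pverts G) (indicator {u}) (weight_vec lam (rank_one_verts G b' u)))))
     \<and>
     (b = None \<longrightarrow>
       (let T = (\<lambda>j. oslash (l2 (layer G u j)) (pverts G) (indicator {(par G ^^ j) u})
                        (weight_vec lam (layer G u j)))
        in orthogonal_decomposition (l2 (pverts G)) (UNIV :: nat set) (\<lambda>j. l2 (layer G u j)) \<and>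
           (\<forall>j. linear_operator_in (l2 (layer G u j)) (T j)) \<and>
           dom (weighted_join G b u lam) = direct_sum_dom UNIV T \<and>
           weighted_join G b u lam = direct_sum UNIV T))"
proof -
  interpret rootless_directed_tree G by fact
  note u = \<open>u \<in> pverts G\<close>
  show ?thesis
  proof (intro conjI allI impI)
    fix b' assume b: "b = Some b'"
    then have b': "b' \<in> pverts G" "u \<noteq> b'" using assms(4,6) by (auto simp: ext_tree_def)
    define V A where "V = pverts G" and "A = diag_verts G b' u"
    have A: "A \<subseteq> V" "u \<in> V - A"
      using diag_verts_subset[OF u] root_not_diag_vert[OF u] u by (auto simp: V_def A_def)
    have K: "orth_compl (l2 V) (l2 A) = l2 (V - A)" using A(1) by (rule orth_compl_l2)
    have disj: "disjoint_family (case_bool A (V - A))"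
      by (auto simp: disjoint_family_on_def split: bool.splits)
    have dec: "orthogonal_decomposition2 (l2 V) (l2 A) (l2 (V - A))"
    proof -
      have "(\<Union>i. case_bool A (V - A) i) = V" using A by (auto simp: UNIV_bool)
      moreover have "(\<lambda>i. l2 (case_bool A (V - A) i)) = case_bool (l2 A) (l2 (V - A))"
        by (auto simp: fun_eq_iff split: bool.split)
      ultimately show ?thesis
        using l2_orthogonal_decomposition[OF disj] by simp
    qed
    define D where "D = diag_op A (\<lambda>v. lam (Some v))"
    define N where "N = oslash (l2 (V - A)) V (indicator {u}) (weight_vec lam (rank_one_verts G b' u))"
    have D: "D = weight_diag G lam |` l2 A"
      using diag_op_restrict[OF A(1)] by (simp add: D_def weight_diag_def V_def)
    have "dom D = {f \<in> l2 A. f \<in> dom (weight_diag G lam) \<and> the (weight_diag G lam f) \<in> l2 A}"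
    proof -
      have "the (weight_diag G lam f) \<in> l2 A" if "f \<in> dom D" for f
      proof -
        from that obtain y where y: "D f = Some y" by blast
        then have "weight_diag G lam f = Some y" by (auto simp: D restrict_map_def split: if_splits)
        with y dom_ran_diag_op(2) show ?thesis by (auto simp: D_def ran_def)
      qed
      moreover have "dom D = l2 A \<inter> dom (weight_diag G lam)" by (auto simp: D)
      ultimately show ?thesis by auto
    qed
    moreover have "weighted_join G b u lam = direct_sum2 D N"
      using weighted_join_vertex[OF u b'] by (simp add: b D_def N_def A_def V_def)
    moreover have "diagonal_operator_in A D" by (auto simp: D_def diagonal_operator_in_def)
    moreover have "densely_defined_in (l2 A) D" unfolding D_def by (rule densely_defined_in_diag_op)
    moreover have "linear_operator_in (l2 (V - A)) N" "rank_at_most 1 N"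
      unfolding N_def using A(2)
      by (intro linear_operator_in_oslash rank_at_most_one_oslash l2_subspace indicator_in_l2; simp)+
    moreover have "densely_defined_in (l2 (V - A)) N" unfolding N_def by (rule densely_defined_in_oslash)
    moreover have "invariant_domain N"
      unfolding N_def using A(2) by (rule invariant_domain_oslash_indicator)
    ultimately show "let H = l2 (diag_verts G b' u); K = orth_compl (l2 (pverts G)) H
        in orthogonal_decomposition2 (l2 (pverts G)) H K \<and>
           (\<exists>D N. weighted_join G b u lam = direct_sum2 D N \<and>
              diagonal_operator_in (diag_verts G b' u) D \<and> densely_defined_in H D \<and>
              linear_operator_in K N \<and> densely_defined_in K N \<and>
              rank_at_most 1 N \<and> invariant_domain N \<and>
              D = weight_diag G lam |` H \<and>
              dom D = {f \<in> H. f \<in> dom (weight_diag G lam) \<and> the (weight_diag G lam f) \<in> H} \<and>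
              N = oslash K (pverts G) (indicator {u}) (weight_vec lam (rank_one_verts G b' u)))"
      unfolding Let_def V_def[symmetric] A_def[symmetric] K using dec D N_def by blast
  next
    assume "b = None"
    then show "let T = (\<lambda>j. oslash (l2 (layer G u j)) (pverts G) (indicator {(par G ^^ j) u})
                        (weight_vec lam (layer G u j)))
        in orthogonal_decomposition (l2 (pverts G)) (UNIV :: nat set) (\<lambda>j. l2 (layer G u j)) \<and>
           (\<forall>j. linear_operator_in (l2 (layer G u j)) (T j)) \<and>
           dom (weighted_join G b u lam) = direct_sum_dom UNIV T \<and>
           weighted_join G b u lam = direct_sum UNIV T"
      using weighted_join_infinity[OF u, where lam = lam] l2_orthogonal_decomposition[OF layer_disjoint[OF u]]
      by (simp add: Let_def layer_UN[OF u])
  qed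
qed

end
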